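(* Let $G=(V,E)$ be a finite connected graph with at least one edge and with girth at least $6$, with edges $E=\{e_1,\dots,e_n\}$, and let $\bar\kappa=2\left(\frac{|V|}{|E|}-1\right)$. Let $\bm\omega_0\in\mathbb{R}^n_{>0}$ be a positive initial value and let $\bm\omega(t)$, $t\ge0$, be the solution of $$\frac{d}{dt}\omega_i(t)=-(\kappa_i(\bm\omega(t))-\bar\kappa)\,\omega_i(t),\quad i=1,\dots,n,\qquad \bm\omega(0)=\bm\omega_0 .$$ Then $\bm\omega(t)$ converges exponentially as $t\to\infty$ to a weight of constant curvature $\bar\kappa$ (i.e. there are $\bm\omega_\infty\in\mathbb{R}^n_{>0}$ with $\kappa_i(\bm\omega_\infty)=\bar\kappa$ for all $i$ and constants $C,\lambda>0$ with $\|\bm\omega(t)-\bm\omega_\infty\|\le Ce^{-\lambda t}$ for all $t\ge 0$) if and only if $$\max_{\emptyset\neq\Omega\subsetneqq V}\frac{|E(\Omega)|}{|\Omega|}<\frac{|E|}{|V|}.$$ Additionally, when this condition holds, along the solution $\tilde{\bm\omega}(t)$ of the un-normalized Ricci flow $\frac{d}{dt}\tilde\omega_i(t)=-\kappa_i(\tilde{\bm\omega}(t))\,\tilde\omega_i(t)$, $i=1,\dots,n$, $\tilde{\bm\omega}(0)=\bm\omega_0$, the curvatures $\kappa_i(\tilde{\bm\omega}(t))$ converge exponentially to $\bar\kappa$ for every $i$.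
   Context: Graphs are finite, connected, undirected and simple. The girth is the length of a shortest cycle; girth at least $6$ means there are no cycles of length $3$, $4$ or $5$ (trees are included). For $\Omega\subseteq V$, $E(\Omega)$ is the set of edges of the subgraph induced by $\Omega$, and $|\cdot|$ denotes cardinality. A weight is a vector $\bm\omega=(\omega_1,\dots,\omega_n)\in\mathbb{R}^n_{>0}$ with $\omega_i=\omega(e_i)$; $\omega_{xy}=\omega_{yx}$ is the weight of edge $(x,y)$. Write $y\sim x$ if $(x,y)\in E$, and $m(x)=\sum_{y\sim x}\omega_{xy}$. The distance $d(u,v)$ is the combinatorial one (number of edges of a shortest path) and does not depend on the weights or on time. Lin-Lu-Yau curvature: for $x\in V$ and $\alpha\in(0,1)$ let $m_x^\alpha$ be the probability measure with $m_x^\alpha(x)=\alpha$, $m_x^\alpha(y)=(1-\alpha)\omega_{xy}/m(x)$ for $y\sim x$, and $0$ otherwise. For $x\ne y$, $\kappa(x,y)=\lim_{\alpha\to1^-}\frac{1}{1-\alpha}\left(1-\frac{W(m_x^\alpha,m_y^\alpha)}{d(x,y)}\right)$, where $W$ is the $1$-Wasserstein distance with respect to $d$. For an edge $e_i=(x,y)$ put $\kappa_i(\bm\omega)=\kappa(x,y)$. On a graph with girth at least $6$ one has, for every edge $e=(x,y)$, $\kappa_e=2\omega_e\left(\frac1{m(x)}+\frac1{m(y)}\right)-2$. The number $\bar\kappa$ is the average curvature $\frac{1}{|E|}\sum_{e\in E}\kappa_e$, which equals $2(|V|/|E|-1)$ for all weights on such graphs. *)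

theory Defs
  imports "HOL-Analysis.Analysis"
begin

text \<open>
  A graph is given by a vertex set \<open>V\<close> and a set \<open>E\<close> of two-element subsets of \<open>V\<close>. A weight is a
  function on edges of which only the values on \<open>E\<close> matter; thus vectors indexed by the enumerated
  edges are rendered as functions indexed by the edges themselves.
\<close>

definition simple_graph :: "'v set \<Rightarrow> 'v set set \<Rightarrow> bool" where
  "simple_graph V E \<longleftrightarrow> finite V \<and> (\<forall>e\<in>E. e \<subseteq> V \<and> card e = 2)"

definition walk_betw :: "'v set set \<Rightarrow> 'v \<Rightarrow> 'v list \<Rightarrow> 'v \<Rightarrow> bool" where
  "walk_betw E u p v \<longleftrightarrow>
     p \<noteq> [] \<and> hd p = u \<and> last p = v \<and> successively (\<lambda>x y. {x, y} \<in> E) p"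

definition connected_graph :: "'v set \<Rightarrow> 'v set set \<Rightarrow> bool" where
  "connected_graph V E \<longleftrightarrow> V \<noteq> {} \<and> (\<forall>u\<in>V. \<forall>v\<in>V. \<exists>p. walk_betw E u p v)"

definition graph_dist :: "'v set set \<Rightarrow> 'v \<Rightarrow> 'v \<Rightarrow> nat" where
  "graph_dist E u v = (LEAST n. \<exists>p. walk_betw E u p v \<and> length p = Suc n)"

definition graph_cycle :: "'v set set \<Rightarrow> 'v list \<Rightarrow> bool" where
  "graph_cycle E c \<longleftrightarrow>
     3 \<le> length c \<and> distinct c \<and> successively (\<lambda>x y. {x, y} \<in> E) c \<and> {last c, hd c} \<in> E"

text \<open>The infimum is \<open>\<infinity>\<close> for a graph without cycles.\<close>

definition girth :: "'v set set \<Rightarrow> enat" where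
  "girth E = (INF c\<in>{c. graph_cycle E c}. enat (length c))"

definition induced_edges :: "'v set set \<Rightarrow> 'v set \<Rightarrow> 'v set set" where
  "induced_edges E \<Omega> = {e\<in>E. e \<subseteq> \<Omega>}"

definition positive_weight :: "'v set set \<Rightarrow> ('v set \<Rightarrow> real) \<Rightarrow> bool" where
  "positive_weight E \<omega> \<longleftrightarrow> (\<forall>e\<in>E. 0 < \<omega> e)"

definition vertex_weight :: "'v set set \<Rightarrow> ('v set \<Rightarrow> real) \<Rightarrow> 'v \<Rightarrow> real" where
  "vertex_weight E \<omega> x = (\<Sum>y | {x, y} \<in> E. \<omega> {x, y})"

text \<open>
  Probability measures on the finite set \<open>V\<close> are represented by their mass functions.
\<close>

definition lazy_measure :: "'v set set \<Rightarrow> ('v set \<Rightarrow> real) \<Rightarrow> real \<Rightarrow> 'v \<Rightarrow> 'v \<Rightarrow> real" where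
  "lazy_measure E \<omega> \<alpha> x y =
     (if y = x then \<alpha>
      else if {x, y} \<in> E then (1 - \<alpha>) * \<omega> {x, y} / vertex_weight E \<omega> x
      else 0)"

definition transport_plan :: "'v set \<Rightarrow> ('v \<Rightarrow> real) \<Rightarrow> ('v \<Rightarrow> real) \<Rightarrow> ('v \<Rightarrow> 'v \<Rightarrow> real) \<Rightarrow> bool" where
  "transport_plan V \<mu> \<nu> \<pi> \<longleftrightarrow>
     (\<forall>x\<in>V. \<forall>y\<in>V. 0 \<le> \<pi> x y) \<and>
     (\<forall>x\<in>V. (\<Sum>y\<in>V. \<pi> x y) = \<mu> x) \<and>
     (\<forall>y\<in>V. (\<Sum>x\<in>V. \<pi> x y) = \<nu> y)"

definition wasserstein :: "'v set \<Rightarrow> 'v set set \<Rightarrow> ('v \<Rightarrow> real) \<Rightarrow> ('v \<Rightarrow> real) \<Rightarrow> real" where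
  "wasserstein V E \<mu> \<nu> =
     (INF \<pi>\<in>{\<pi>. transport_plan V \<mu> \<nu> \<pi>}.
        \<Sum>x\<in>V. \<Sum>y\<in>V. real (graph_dist E x y) * \<pi> x y)"

definition lly_curvature ::
  "'v set \<Rightarrow> 'v set set \<Rightarrow> ('v set \<Rightarrow> real) \<Rightarrow> 'v \<Rightarrow> 'v \<Rightarrow> real" where
  "lly_curvature V E \<omega> x y =
     Lim (at_left 1) (\<lambda>\<alpha>. 1 / (1 - \<alpha>) *
       (1 - wasserstein V E (lazy_measure E \<omega> \<alpha> x) (lazy_measure E \<omega> \<alpha> y)
              / real (graph_dist E x y)))"

text \<open>
  The curvature is symmetric in its two endpoints, so the value attached to an undirected edge
  does not depend on the chosen orientation.
\<close>

definition edge_curvature ::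
  "'v set \<Rightarrow> 'v set set \<Rightarrow> ('v set \<Rightarrow> real) \<Rightarrow> 'v set \<Rightarrow> real" where
  "edge_curvature V E \<omega> e = (THE k. \<forall>x y. e = {x, y} \<longrightarrow> lly_curvature V E \<omega> x y = k)"

definition mean_curvature :: "'v set \<Rightarrow> 'v set set \<Rightarrow> real" where
  "mean_curvature V E = 2 * (real (card V) / real (card E) - 1)"

text \<open>
  A solution on \<open>[0, \<infinity>)\<close> of \<open>d\<omega>\<^sub>e/dt = -(\<kappa>\<^sub>e(\<omega>) - c) \<omega>\<^sub>e\<close> with initial value \<open>\<omega>\<^sub>0\<close>. Positivity is
  part of being a solution, since the curvature is defined for positive weights only.
  The un-normalized flow is the case \<open>c = 0\<close>.
\<close>

definition ricci_flow_solution ::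
  "'v set \<Rightarrow> 'v set set \<Rightarrow> real \<Rightarrow> ('v set \<Rightarrow> real) \<Rightarrow> (real \<Rightarrow> 'v set \<Rightarrow> real) \<Rightarrow> bool" where
  "ricci_flow_solution V E c \<omega>\<^sub>0 \<omega> \<longleftrightarrow>
     (\<forall>e\<in>E. \<omega> 0 e = \<omega>\<^sub>0 e) \<and>
     (\<forall>t\<ge>0. positive_weight E (\<omega> t)) \<and>
     (\<forall>t\<ge>0. \<forall>e\<in>E. ((\<lambda>s. \<omega> s e) has_real_derivative
         - (edge_curvature V E (\<omega> t) e - c) * \<omega> t e) (at t within {0..}))"

definition converges_exp_to_constant_curvature ::
  "'v set \<Rightarrow> 'v set set \<Rightarrow> real \<Rightarrow> (real \<Rightarrow> 'v set \<Rightarrow> real) \<Rightarrow> bool" where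
  "converges_exp_to_constant_curvature V E c \<omega> \<longleftrightarrow>
     (\<exists>\<eta>. positive_weight E \<eta> \<and>
        (\<forall>e\<in>E. edge_curvature V E \<eta> e = c) \<and>
        (\<exists>C>0. \<exists>r>0. \<forall>t\<ge>0. L2_set (\<lambda>e. \<omega> t e - \<eta> e) E \<le> C * exp (- r * t)))"

definition max_density_condition :: "'v set \<Rightarrow> 'v set set \<Rightarrow> bool" where
  "max_density_condition V E \<longleftrightarrow>
     Max ((\<lambda>\<Omega>. real (card (induced_edges E \<Omega>)) / real (card \<Omega>)) ` {\<Omega>. \<Omega> \<noteq> {} \<and> \<Omega> \<subset> V})
       < real (card E) / real (card V)"

end

theory Submission
  imports Defs
begin

text \<open>
  In girth at least six, transport between the two ends of an edge is explicit, and
  \<open>\<kappa>\<^sub>e = 2 \<Sum>x\<in>e. p x e - 2\<close> with \<open>p x e = \<omega>\<^sub>e / m(x)\<close>, the share of \<open>e\<close> in the weight at its end \<open>x\<close>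
  (lemma \<open>edge_curvature_girth6\<close>). The shares at a vertex sum to one. Write \<open>k\<^sub>e\<close> for \<open>\<kappa>\<^sub>e\<close> minus its mean and
  \<open>c = |V|/|E|\<close>, so \<open>k\<^sub>e = 2 (\<Sum>x\<in>e. p x e - c)\<close>.

  Necessity is a double count at the limit weight: if \<open>k = 0\<close>, the edges inside \<open>\<Omega>\<close> absorb the amount
  \<open>c |E(\<Omega>)|\<close> out of the total \<open>|\<Omega>|\<close> available at vertices of \<open>\<Omega>\<close>, and by connectedness some of this
  total goes to an edge leaving \<open>\<Omega>\<close> (lemma \<open>constant_curvature_imp_density\<close>).

  Sufficiency rests on convexity. In the coordinates \<open>u = ln \<omega>\<close> the flow \<open>u' = -k\<close> is a gradient flow of the
  convex function \<open>F = \<Sum>x. ln m(x) - c \<Sum>e. u\<^sub>e\<close>, and it preserves \<open>\<Sum>e. u\<^sub>e\<close>. Since \<open>ln m(x)\<close> is at least the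
  largest \<open>u\<^sub>e\<close> at \<open>x\<close>, a layer-cake argument turns the density condition into
  \<open>F \<ge> \<delta> (max u - min u)\<close> (lemma \<open>density_imp_coercive\<close>). As \<open>F\<close> decreases along the flow, \<open>u\<close> stays bounded
  and the shares stay above a positive constant. The Hessian of \<open>F\<close> is a sum of variances with the
  shares as probabilities, and a Poincare inequality on the connected graph bounds it below on vectors of
  zero sum, such as \<open>k\<close>. Therefore \<open>\<Sum>e. k\<^sub>e\<^sup>2\<close> decays exponentially (lemma \<open>excess_decays\<close>). Integrating
  \<open>\<omega>' = -k \<omega>\<close> gives an exponentially approached positive limit, and \<open>k\<close> vanishes there by continuity.

  Curvature is invariant under scaling of the weight, and multiplying a solution of the un-normalized flow by
  \<open>exp (\<kappa> t)\<close>, with \<open>\<kappa>\<close> the mean curvature, gives a solution of the normalized one. So the decay of \<open>k\<close>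
  holds for both flows.
\<close>

section \<open>Distances in graphs without short cycles\<close>

lemma graph_dist_eqI:
  assumes "walk_betw E u p v" "length p = Suc n"
    and "\<And>q. walk_betw E u q v \<Longrightarrow> n < length q"
  shows "graph_dist E u v = n"
  unfolding graph_dist_def
proof (rule Least_equality)
  show "\<exists>p. walk_betw E u p v \<and> length p = Suc n" using assms by blast
next
  fix k assume "\<exists>p. walk_betw E u p v \<and> length p = Suc k"
  then show "n \<le> k" using assms(3) by fastforce
qed

lemma graph_dist_self: "graph_dist E u u = 0"
  by (rule graph_dist_eqI[where p="[u]"]) (auto simp: walk_betw_def)

lemma girth_le_cycle_length:
  assumes "graph_cycle E c" "6 \<le> girth E" shows "6 \<le> length c"
proof -
  have "girth E \<le> enat (length c)"
    unfolding girth_def using assms(1) by (intro INF_lower) simp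
  with assms(2) have "6 \<le> enat (length c)" by (rule order.trans)
  then show ?thesis by (simp add: numeral_eq_enat)
qed

lemma simple_graph_endpoints:
  assumes "simple_graph V E" "{x, y} \<in> E"
  shows "x \<in> V" "y \<in> V" "x \<noteq> y"
proof -
  have "{x, y} \<subseteq> V \<and> card {x, y} = 2" using assms unfolding simple_graph_def by blast
  then show "x \<in> V" "y \<in> V" "x \<noteq> y" by auto
qed

text \<open>
  Below, a path of at most three edges is a geodesic because a shorter connection between its ends
  would close a cycle with at most five edges.
\<close>

lemma no_triangle:
  assumes "simple_graph V E" "6 \<le> girth E" "{a, b} \<in> E" "{b, c} \<in> E"
  shows "{c, a} \<notin> E"
proof
  assume ca: "{c, a} \<in> E"
  have "a \<noteq> b" "b \<noteq> c" "c \<noteq> a"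
    using simple_graph_endpoints(3)[OF assms(1)] assms(3,4) ca by auto
  then have "graph_cycle E [a, b, c]"
    using assms ca by (auto simp: graph_cycle_def)
  from girth_le_cycle_length[OF this assms(2)] show False by simp
qed

lemma no_quadrangle:
  assumes "simple_graph V E" "6 \<le> girth E" "{a, b} \<in> E" "{b, c} \<in> E" "{c, d} \<in> E"
    and "a \<noteq> c" "b \<noteq> d"
  shows "{d, a} \<notin> E"
proof
  assume da: "{d, a} \<in> E"
  have "a \<noteq> b" "b \<noteq> c" "c \<noteq> d" "d \<noteq> a"
    using simple_graph_endpoints(3)[OF assms(1)] assms(3-5) da by auto
  then have "graph_cycle E [a, b, c, d]"
    using assms da by (auto simp: graph_cycle_def)
  from girth_le_cycle_length[OF this assms(2)] show False by simp
qed

lemma no_pentagon: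
  assumes "simple_graph V E" "6 \<le> girth E"
    and "{a, b} \<in> E" "{b, c} \<in> E" "{c, d} \<in> E" "{d, z} \<in> E" "a \<noteq> c" "b \<noteq> d"
  shows "{z, a} \<notin> E"
proof
  assume za: "{z, a} \<in> E"
  have ne: "a \<noteq> b" "b \<noteq> c" "c \<noteq> d" "d \<noteq> z" "z \<noteq> a"
    using simple_graph_endpoints(3)[OF assms(1)] assms(3-6) za by auto
  have "a \<noteq> d" using no_triangle[OF assms(1-4)] assms(5) by auto
  moreover have "z \<noteq> b"
    using no_triangle[OF assms(1,2,4,5)] assms(6) by auto
  moreover have "z \<noteq> c"
    using no_triangle[OF assms(1-4)] za by auto
  ultimately have "graph_cycle E [a, b, c, d, z]"
    using assms za ne by (auto simp: graph_cycle_def)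
  from girth_le_cycle_length[OF this assms(2)] show False by simp
qed

lemma walk_length_1: "walk_betw E u q v \<Longrightarrow> length q = Suc 0 \<Longrightarrow> u = v"
  by (auto simp: walk_betw_def length_Suc_conv)

lemma walk_length_2: "walk_betw E u q v \<Longrightarrow> length q = Suc (Suc 0) \<Longrightarrow> {u, v} \<in> E"
  by (auto simp: walk_betw_def length_Suc_conv)

lemma walk_length_3:
  "walk_betw E u q v \<Longrightarrow> length q = Suc (Suc (Suc 0)) \<Longrightarrow> \<exists>z. {u, z} \<in> E \<and> {z, v} \<in> E"
  by (auto simp: walk_betw_def length_Suc_conv)

lemma walk_length_pos: "walk_betw E u q v \<Longrightarrow> 0 < length q"
  by (auto simp: walk_betw_def)

lemma graph_dist_edge:
  assumes "simple_graph V E" "{a, b} \<in> E"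
  shows "graph_dist E a b = 1"
proof (rule graph_dist_eqI[where p="[a, b]"])
  fix q assume q: "walk_betw E a q b"
  have "length q \<noteq> Suc 0"
    using walk_length_1[OF q] simple_graph_endpoints(3)[OF assms] by auto
  then show "1 < length q" using walk_length_pos[OF q] by linarith
qed (use assms in \<open>auto simp: walk_betw_def\<close>)

lemma graph_dist_path2:
  assumes "simple_graph V E" "6 \<le> girth E" "{a, b} \<in> E" "{b, c} \<in> E" "a \<noteq> c"
  shows "graph_dist E a c = 2"
proof (rule graph_dist_eqI[where p="[a, b, c]"])
  fix q assume q: "walk_betw E a q c"
  have "length q \<noteq> Suc 0" using walk_length_1[OF q] assms(5) by auto
  moreover have "length q \<noteq> Suc (Suc 0)"
    using walk_length_2[OF q] no_triangle[OF assms(1-4)] by (auto simp: insert_commute)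
  ultimately show "2 < length q" using walk_length_pos[OF q] by linarith
qed (use assms in \<open>auto simp: walk_betw_def\<close>)

lemma graph_dist_path3:
  assumes "simple_graph V E" "6 \<le> girth E"
    and "{a, b} \<in> E" "{b, c} \<in> E" "{c, d} \<in> E" "a \<noteq> c" "b \<noteq> d"
  shows "graph_dist E a d = 3"
proof (rule graph_dist_eqI[where p="[a, b, c, d]"])
  fix q assume q: "walk_betw E a q d"
  have "length q \<noteq> Suc 0"
    using walk_length_1[OF q] no_triangle[OF assms(1-4)] assms(5) by auto
  moreover have "length q \<noteq> Suc (Suc 0)"
    using walk_length_2[OF q] no_quadrangle[OF assms] by (auto simp: insert_commute)
  moreover have "length q \<noteq> Suc (Suc (Suc 0))"
    using walk_length_3[OF q] no_pentagon[OF assms(1-5) _ assms(6,7)]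
    by (auto simp: insert_commute)
  ultimately show "3 < length q" using walk_length_pos[OF q] by linarith
qed (use assms in \<open>auto simp: walk_betw_def\<close>)


section \<open>The Wasserstein distance by complementary slackness\<close>

text \<open>
  The easy half of Kantorovich duality: summing \<open>f u - f v \<le> d u v\<close> against any plan bounds its
  cost below by \<open>\<Sum>f\<mu> - \<Sum>f\<nu>\<close>, and a plan that charges only pairs with equality attains the bound.
  A plan charges only pairs from the two supports, which is where the Lipschitz condition is imposed.
\<close>

lemma wasserstein_eqI:
  fixes f :: "'v \<Rightarrow> real"
  assumes V: "finite V"
    and plan: "transport_plan V \<mu> \<nu> \<pi>\<^sub>0"
    and tight: "\<And>u v. \<lbrakk>u \<in> V; v \<in> V; \<pi>\<^sub>0 u v \<noteq> 0\<rbrakk> \<Longrightarrow> real (graph_dist E u v) = f u - f v"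
    and lip: "\<And>u v. \<lbrakk>u \<in> V; v \<in> V; \<mu> u \<noteq> 0; \<nu> v \<noteq> 0\<rbrakk> \<Longrightarrow> f u - f v \<le> real (graph_dist E u v)"
  shows "wasserstein V E \<mu> \<nu> = (\<Sum>u\<in>V. f u * \<mu> u) - (\<Sum>v\<in>V. f v * \<nu> v)"
proof -
  have dual: "(\<Sum>u\<in>V. \<Sum>v\<in>V. (f u - f v) * \<pi> u v) = (\<Sum>u\<in>V. f u * \<mu> u) - (\<Sum>v\<in>V. f v * \<nu> v)"
    if "transport_plan V \<mu> \<nu> \<pi>" for \<pi>
  proof -
    have "(\<Sum>u\<in>V. \<Sum>v\<in>V. (f u - f v) * \<pi> u v)
        = (\<Sum>u\<in>V. \<Sum>v\<in>V. f u * \<pi> u v) - (\<Sum>u\<in>V. \<Sum>v\<in>V. f v * \<pi> u v)"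
      by (simp add: left_diff_distrib sum_subtractf)
    also have "(\<Sum>u\<in>V. \<Sum>v\<in>V. f v * \<pi> u v) = (\<Sum>v\<in>V. \<Sum>u\<in>V. f v * \<pi> u v)"
      by (rule sum.swap)
    finally show ?thesis
      using that by (simp add: transport_plan_def flip: sum_distrib_left)
  qed
  have lower: "(\<Sum>u\<in>V. \<Sum>v\<in>V. (f u - f v) * \<pi> u v)
      \<le> (\<Sum>u\<in>V. \<Sum>v\<in>V. real (graph_dist E u v) * \<pi> u v)"
    if p: "transport_plan V \<mu> \<nu> \<pi>" for \<pi>
  proof (intro sum_mono)
    fix u v assume uv: "u \<in> V" "v \<in> V"
    have nn: "0 \<le> \<pi> u v" using p uv by (simp add: transport_plan_def)
    show "(f u - f v) * \<pi> u v \<le> real (graph_dist E u v) * \<pi> u v"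
    proof (cases "\<pi> u v = 0")
      case False
      with nn have pos: "0 < \<pi> u v" by simp
      have "\<pi> u v \<le> (\<Sum>w\<in>V. \<pi> u w)"
        by (rule member_le_sum) (use p uv V in \<open>auto simp: transport_plan_def\<close>)
      moreover have "\<pi> u v \<le> (\<Sum>w\<in>V. \<pi> w v)"
        by (rule member_le_sum[where f="\<lambda>w. \<pi> w v"]) (use p uv V in \<open>auto simp: transport_plan_def\<close>)
      ultimately have "\<mu> u \<noteq> 0" "\<nu> v \<noteq> 0"
        using p uv pos by (auto simp: transport_plan_def)
      then show ?thesis using lip uv nn by (intro mult_right_mono) auto
    qed simp
  qed
  have opt: "(\<Sum>u\<in>V. \<Sum>v\<in>V. real (graph_dist E u v) * \<pi>\<^sub>0 u v)
      = (\<Sum>u\<in>V. \<Sum>v\<in>V. (f u - f v) * \<pi>\<^sub>0 u v)"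
    by (intro sum.cong refl) (metis mult_zero_right tight)
  show ?thesis
    unfolding wasserstein_def
  proof (rule cInf_eq_minimum)
    show "(\<Sum>u\<in>V. f u * \<mu> u) - (\<Sum>v\<in>V. f v * \<nu> v)
        \<in> (\<lambda>\<pi>. \<Sum>x\<in>V. \<Sum>y\<in>V. real (graph_dist E x y) * \<pi> x y) ` {\<pi>. transport_plan V \<mu> \<nu> \<pi>}"
      using opt dual[OF plan] plan by (intro image_eqI[where x=\<pi>\<^sub>0]) auto
  next
    fix c assume "c \<in> (\<lambda>\<pi>. \<Sum>x\<in>V. \<Sum>y\<in>V. real (graph_dist E x y) * \<pi> x y) ` {\<pi>. transport_plan V \<mu> \<nu> \<pi>}"
    then show "(\<Sum>u\<in>V. f u * \<mu> u) - (\<Sum>v\<in>V. f v * \<nu> v) \<le> c"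
      using lower dual by fastforce
  qed
qed

text \<open>
  The plan that leaves the common mass \<open>min \<mu> \<nu>\<close> in place and spreads each excess proportionally over
  the deficits. It never moves mass out of a vertex where \<open>\<mu>\<close> is at most \<open>\<nu>\<close>. Equal measures are
  covered, the quotient being zero then.
\<close>

definition common_mass_plan :: "'v set \<Rightarrow> ('v \<Rightarrow> real) \<Rightarrow> ('v \<Rightarrow> real) \<Rightarrow> 'v \<Rightarrow> 'v \<Rightarrow> real" where
  "common_mass_plan V \<mu> \<nu> u v =
     (if u = v then min (\<mu> u) (\<nu> u) else 0)
     + (\<mu> u - min (\<mu> u) (\<nu> u)) * (\<nu> v - min (\<mu> v) (\<nu> v)) / (\<Sum>w\<in>V. \<mu> w - min (\<mu> w) (\<nu> w))"

lemma transport_plan_common_mass: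
  assumes V: "finite V" and nn: "\<And>v. v \<in> V \<Longrightarrow> 0 \<le> \<mu> v" "\<And>v. v \<in> V \<Longrightarrow> 0 \<le> \<nu> v"
    and tot: "(\<Sum>v\<in>V. \<mu> v) = (\<Sum>v\<in>V. \<nu> v)"
  shows "transport_plan V \<mu> \<nu> (common_mass_plan V \<mu> \<nu>)"
proof -
  define T where "T = (\<Sum>w\<in>V. \<mu> w - min (\<mu> w) (\<nu> w))"
  have T': "(\<Sum>w\<in>V. \<nu> w - min (\<mu> w) (\<nu> w)) = T"
    using tot by (simp add: T_def sum_subtractf)
  have T0: "0 \<le> T" unfolding T_def by (intro sum_nonneg) simp
  have ex: "\<mu> u - min (\<mu> u) (\<nu> u) = 0" "\<nu> u - min (\<mu> u) (\<nu> u) = 0" if "T = 0" "u \<in> V" for u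
  proof -
    have "\<forall>w\<in>V. \<mu> w - min (\<mu> w) (\<nu> w) = 0"
      using that(1) V unfolding T_def by (subst (asm) sum_nonneg_eq_0_iff) auto
    then show "\<mu> u - min (\<mu> u) (\<nu> u) = 0" using that(2) by blast
    have "\<forall>w\<in>V. \<nu> w - min (\<mu> w) (\<nu> w) = 0"
      using that(1) V unfolding T'[symmetric] by (subst (asm) sum_nonneg_eq_0_iff) auto
    then show "\<nu> u - min (\<mu> u) (\<nu> u) = 0" using that(2) by blast
  qed
  show ?thesis
    unfolding transport_plan_def
  proof (intro conjI ballI)
    fix x y assume "x \<in> V" "y \<in> V"
    then show "0 \<le> common_mass_plan V \<mu> \<nu> x y"
      unfolding common_mass_plan_def T_def[symmetric]
      using nn T0 by (intro add_nonneg_nonneg divide_nonneg_nonneg mult_nonneg_nonneg) auto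
  next
    fix x assume x: "x \<in> V"
    have "(\<Sum>y\<in>V. common_mass_plan V \<mu> \<nu> x y)
        = min (\<mu> x) (\<nu> x) + (\<mu> x - min (\<mu> x) (\<nu> x)) * T / T"
      unfolding common_mass_plan_def T_def[symmetric] sum.distrib
      using V x by (simp add: T' flip: sum_divide_distrib sum_distrib_left)
    then show "(\<Sum>y\<in>V. common_mass_plan V \<mu> \<nu> x y) = \<mu> x"
      using ex(1)[OF _ x] by (cases "T = 0") auto
  next
    fix y assume y: "y \<in> V"
    have "(\<Sum>x\<in>V. common_mass_plan V \<mu> \<nu> x y)
        = min (\<mu> y) (\<nu> y) + T * (\<nu> y - min (\<mu> y) (\<nu> y)) / T"
      unfolding common_mass_plan_def T_def[symmetric] sum.distrib
      using V y by (simp add: T_def flip: sum_divide_distrib sum_distrib_right)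
    then show "(\<Sum>x\<in>V. common_mass_plan V \<mu> \<nu> x y) = \<nu> y"
      using ex(2)[OF _ y] by (cases "T = 0") auto
  qed
qed

lemma common_mass_plan_support:
  assumes "common_mass_plan V \<mu> \<nu> u v \<noteq> 0"
  shows "u = v \<or> (\<nu> u < \<mu> u \<and> \<mu> v < \<nu> v)"
  using assms by (auto simp: common_mass_plan_def min_def split: if_splits)


section \<open>Curvature of an edge\<close>

lemma finite_neighbours:
  assumes "simple_graph V E" shows "finite {y. {x, y} \<in> E}"
  by (rule finite_subset[of _ V])
    (use assms simple_graph_endpoints(2)[OF assms] in \<open>auto simp: simple_graph_def\<close>)

lemma vertex_weight_pos:
  assumes "simple_graph V E" "positive_weight E \<omega>" "{x, y} \<in> E"
  shows "0 < vertex_weight E \<omega> x"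
  unfolding vertex_weight_def
  by (rule sum_pos[OF finite_neighbours[OF assms(1)]])
    (use assms in \<open>auto simp: positive_weight_def\<close>)

lemma edge_weight_le_vertex_weight:
  assumes "simple_graph V E" "positive_weight E \<omega>" "{x, y} \<in> E"
  shows "\<omega> {x, y} \<le> vertex_weight E \<omega> x"
  unfolding vertex_weight_def
  by (rule member_le_sum[where f="\<lambda>y. \<omega> {x, y}"])
    (use assms finite_neighbours[OF assms(1)] in \<open>auto simp: positive_weight_def less_imp_le\<close>)

lemma sum_lazy_measure:
  assumes G: "simple_graph V E" and x: "x \<in> V"
  shows "(\<Sum>v\<in>V. f v * lazy_measure E \<omega> \<alpha> x v)
    = \<alpha> * f x + (1 - \<alpha>) / vertex_weight E \<omega> x * (\<Sum>y | {x, y} \<in> E. f y * \<omega> {x, y})"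
proof -
  let ?N = "{y. {x, y} \<in> E}"
  have V: "finite V" using G by (simp add: simple_graph_def)
  have N: "?N \<subseteq> V - {x}" using simple_graph_endpoints(2,3)[OF G, of x] by blast
  have "(\<Sum>v\<in>V. f v * lazy_measure E \<omega> \<alpha> x v)
      = f x * \<alpha> + (\<Sum>v\<in>V - {x}. f v * lazy_measure E \<omega> \<alpha> x v)"
    by (subst sum.remove[OF V x]) (simp add: lazy_measure_def)
  also have "(\<Sum>v\<in>V - {x}. f v * lazy_measure E \<omega> \<alpha> x v)
      = (\<Sum>v\<in>?N. f v * lazy_measure E \<omega> \<alpha> x v)"
    by (rule sum.mono_neutral_right) (use V N in \<open>auto simp: lazy_measure_def\<close>)
  also have "\<dots> = (\<Sum>v\<in>?N. (1 - \<alpha>) / vertex_weight E \<omega> x * (f v * \<omega> {x, v}))"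
    by (rule sum.cong) (use N in \<open>auto simp: lazy_measure_def\<close>)
  finally show ?thesis by (simp add: sum_distrib_left)
qed

lemma sum_lazy_measure_two_values:
  assumes G: "simple_graph V E" and "positive_weight E \<omega>" and xy: "{x, y} \<in> E"
    and f: "\<And>v. {x, v} \<in> E \<Longrightarrow> v \<noteq> y \<Longrightarrow> f v = c"
  shows "(\<Sum>v\<in>V. f v * lazy_measure E \<omega> \<alpha> x v)
    = \<alpha> * f x + (1 - \<alpha>) * (c + (f y - c) * \<omega> {x, y} / vertex_weight E \<omega> x)"
proof -
  let ?N = "{y. {x, y} \<in> E}"
  have m: "0 < vertex_weight E \<omega> x" using vertex_weight_pos[OF assms(1-3)] .
  have fin: "finite ?N" using finite_neighbours[OF G] .
  have "(\<Sum>v\<in>?N. f v * \<omega> {x, v}) = f y * \<omega> {x, y} + (\<Sum>v\<in>?N - {y}. f v * \<omega> {x, v})"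
    using fin xy by (subst sum.remove[of _ y]) auto
  also have "(\<Sum>v\<in>?N - {y}. f v * \<omega> {x, v}) = (\<Sum>v\<in>?N - {y}. c * \<omega> {x, v})"
    by (rule sum.cong) (use f in auto)
  also have "\<dots> = c * (vertex_weight E \<omega> x - \<omega> {x, y})"
    unfolding vertex_weight_def using fin xy
    by (simp add: sum_diff1 flip: sum_distrib_left)
  finally have S: "(\<Sum>v\<in>?N. f v * \<omega> {x, v}) = c * vertex_weight E \<omega> x + (f y - c) * \<omega> {x, y}"
    by (simp add: algebra_simps)
  show ?thesis
    unfolding sum_lazy_measure[OF G simple_graph_endpoints(1)[OF G xy]] S
    using m by (simp add: field_simps)
qed

text \<open>
  The potential \<open>f\<close> is \<open>2\<close> on the other neighbours of \<open>x\<close>, then \<open>1\<close>, \<open>0\<close> on \<open>x\<close>, \<open>y\<close>, and \<open>-1\<close> on the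
  other neighbours of \<open>y\<close>: it drops by one along every path \<open>x' x y y'\<close>, and girth six makes these
  paths geodesic. Transporting from \<open>y\<close> to \<open>x\<close> is the only move between the two supports that is not
  tight for \<open>f\<close>. For \<open>\<alpha> \<ge> 1/2\<close> the vertex \<open>y\<close> has no excess, so the common-mass plan avoids that move.
\<close>

lemma wasserstein_lazy_measure:
  assumes G: "simple_graph V E" and g: "6 \<le> girth E" and w: "positive_weight E \<omega>"
    and xy: "{x, y} \<in> E" and \<alpha>: "1 / 2 < \<alpha>" "\<alpha> < 1"
  shows "wasserstein V E (lazy_measure E \<omega> \<alpha> x) (lazy_measure E \<omega> \<alpha> y)
    = 1 - (1 - \<alpha>) * (2 * \<omega> {x, y} / vertex_weight E \<omega> x + 2 * \<omega> {x, y} / vertex_weight E \<omega> y - 2)"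
proof -
  let ?\<mu> = "lazy_measure E \<omega> \<alpha> x" and ?\<nu> = "lazy_measure E \<omega> \<alpha> y"
  define f :: "'a \<Rightarrow> real" where
    "f v = (if v = x then 1 else if v = y then 0 else if {x, v} \<in> E then 2 else -1)" for v
  have V: "finite V" using G by (simp add: simple_graph_def)
  have yx: "{y, x} \<in> E" using xy by (simp add: insert_commute)
  have xV: "x \<in> V" and yV: "y \<in> V" and ne: "x \<noteq> y"
    using simple_graph_endpoints[OF G xy] by auto
  have nn: "0 \<le> lazy_measure E \<omega> \<alpha> z v" for z v
  proof (cases "{z, v} \<in> E")
    case True
    then have "0 < vertex_weight E \<omega> z" "0 < \<omega> {z, v}"
      using vertex_weight_pos[OF G w] w by (auto simp: positive_weight_def)
    then show ?thesis using \<alpha> by (auto simp: lazy_measure_def)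
  qed (use \<alpha> in \<open>auto simp: lazy_measure_def\<close>)
  have tot: "(\<Sum>v\<in>V. lazy_measure E \<omega> \<alpha> z v) = 1" if "{z, z'} \<in> E" for z z'
    using sum_lazy_measure_two_values[OF G w that, where f="\<lambda>_. 1" and c=1 and \<alpha>=\<alpha>] by simp
  have plan: "transport_plan V ?\<mu> ?\<nu> (common_mass_plan V ?\<mu> ?\<nu>)"
    by (rule transport_plan_common_mass) (use V nn tot xy yx in auto)
  have fx': "f u = 2" if "{x, u} \<in> E" "u \<noteq> y" for u
    using that simple_graph_endpoints(3)[OF G that(1)] by (auto simp: f_def)
  have fy': "f v = -1" if "{y, v} \<in> E" "v \<noteq> x" for v
    using that simple_graph_endpoints(3)[OF G that(1)] no_triangle[OF G g xy that(1)]
    by (auto simp: f_def insert_commute)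
  have fx: "f x = 1" and fy: "f y = 0" using ne by (auto simp: f_def)
  have small: "lazy_measure E \<omega> \<alpha> z z' \<le> \<alpha>" if "{z, z'} \<in> E" for z z'
  proof -
    have "\<omega> {z, z'} / vertex_weight E \<omega> z \<le> 1"
      using edge_weight_le_vertex_weight[OF G w that] vertex_weight_pos[OF G w that] by simp
    then have "(1 - \<alpha>) * (\<omega> {z, z'} / vertex_weight E \<omega> z) \<le> (1 - \<alpha>) * 1"
      using \<alpha> by (intro mult_left_mono) auto
    then show ?thesis using \<alpha> that by (auto simp: lazy_measure_def)
  qed
  have tight: "real (graph_dist E u v) = f u - f v"
    if u: "u = x \<or> {x, u} \<in> E \<and> u \<noteq> y" and v: "v = y \<or> {y, v} \<in> E \<and> v \<noteq> x" for u v
  proof -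
    consider "u = x" "v = y" | "u = x" "{y, v} \<in> E" "v \<noteq> x"
      | "{u, x} \<in> E" "u \<noteq> y" "v = y" | "{u, x} \<in> E" "u \<noteq> y" "{y, v} \<in> E" "v \<noteq> x"
      using u v by (auto simp: insert_commute)
    then show ?thesis
    proof cases
      case 1 then show ?thesis using graph_dist_edge[OF G xy] fx fy by simp
    next
      case 2 then show ?thesis using graph_dist_path2[OF G g xy] fx fy' by simp
    next
      case 3 then show ?thesis
        using graph_dist_path2[OF G g _ xy] fy fx'[of u] by (simp add: insert_commute)
    next
      case 4 then show ?thesis
        using graph_dist_path3[OF G g _ xy] fy'[of v] fx'[of u] by (simp add: insert_commute)
    qed
  qed
  have "wasserstein V E ?\<mu> ?\<nu> = (\<Sum>u\<in>V. f u * ?\<mu> u) - (\<Sum>v\<in>V. f v * ?\<nu> v)"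
  proof (rule wasserstein_eqI[OF V plan])
    fix u v assume "u \<in> V" "v \<in> V" and c: "common_mass_plan V ?\<mu> ?\<nu> u v \<noteq> 0"
    show "real (graph_dist E u v) = f u - f v"
    proof (cases "u = v")
      case False
      then have lt: "?\<nu> u < ?\<mu> u" "?\<mu> v < ?\<nu> v" using common_mass_plan_support[OF c] by auto
      have "u \<noteq> y" using lt(1) small[OF xy] by (auto simp: lazy_measure_def)
      moreover have "v \<noteq> x" using lt(2) small[OF yx] by (auto simp: lazy_measure_def)
      moreover have "?\<mu> u \<noteq> 0" "?\<nu> v \<noteq> 0" using lt nn[of y u] nn[of x v] by auto
      ultimately show ?thesis
        by (intro tight) (auto simp: lazy_measure_def split: if_splits)
    qed (simp add: graph_dist_self)
  next
    fix u v assume "u \<in> V" "v \<in> V" and nz: "?\<mu> u \<noteq> 0" "?\<nu> v \<noteq> 0"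
    have u: "u = x \<or> {x, u} \<in> E" and v: "v = y \<or> {y, v} \<in> E"
      using nz by (auto simp: lazy_measure_def split: if_splits)
    show "f u - f v \<le> real (graph_dist E u v)"
    proof (cases "u = y \<or> v = x")
      case True
      consider "u = v" | "u = y" "v = x" | "u = y" "{y, v} \<in> E" "v \<noteq> x" | "v = x" "{x, u} \<in> E" "u \<noteq> y"
        using True u v by auto
      then show ?thesis
      proof cases
        case 1 then show ?thesis by simp
      next
        case 2 then show ?thesis using fx fy by simp
      next
        case 3 then show ?thesis using fy fy' graph_dist_edge[OF G, of y v] by simp
      next
        case 4 then show ?thesis
          using fx fx' graph_dist_edge[OF G, of u x] by (simp add: insert_commute)
      qed
    next
      case False
      then show ?thesis using tight[of u v] u v by simp
    qed
  qed
  also have "\<dots> = (\<alpha> * 1 + (1 - \<alpha>) * (2 + (0 - 2) * \<omega> {x, y} / vertex_weight E \<omega> x))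
      - (\<alpha> * 0 + (1 - \<alpha>) * (- 1 + (1 - - 1) * \<omega> {y, x} / vertex_weight E \<omega> y))"
    using sum_lazy_measure_two_values[OF G w xy, where f=f and c=2 and \<alpha>=\<alpha>] fx'
      sum_lazy_measure_two_values[OF G w yx, where f=f and c="-1" and \<alpha>=\<alpha>] fy' fx fy
    by simp
  finally show ?thesis by (simp add: algebra_simps insert_commute)
qed

lemma lly_curvature_edge:
  assumes G: "simple_graph V E" and g: "6 \<le> girth E" and w: "positive_weight E \<omega>"
    and xy: "{x, y} \<in> E"
  shows "lly_curvature V E \<omega> x y
    = 2 * \<omega> {x, y} / vertex_weight E \<omega> x + 2 * \<omega> {x, y} / vertex_weight E \<omega> y - 2"
    (is "_ = ?k")
  unfolding lly_curvature_def
proof (rule tendsto_Lim[OF trivial_limit_at_left_real tendsto_eventually])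
  have "\<forall>\<^sub>F \<alpha> in at_left 1. \<alpha> \<in> {1 / 2<..<1::real}" by (rule eventually_at_left_real) simp
  then show "\<forall>\<^sub>F \<alpha> in at_left 1. 1 / (1 - \<alpha>) *
      (1 - wasserstein V E (lazy_measure E \<omega> \<alpha> x) (lazy_measure E \<omega> \<alpha> y) / real (graph_dist E x y)) = ?k"
    by eventually_elim
      (simp add: wasserstein_lazy_measure[OF G g w xy] graph_dist_edge[OF G xy])
qed

lemma edge_curvature_girth6:
  assumes G: "simple_graph V E" and g: "6 \<le> girth E" and w: "positive_weight E \<omega>"
    and e: "e \<in> E"
  shows "edge_curvature V E \<omega> e = 2 * (\<Sum>x\<in>e. \<omega> e / vertex_weight E \<omega> x) - 2"
proof -
  have "card e = 2" using G e by (simp add: simple_graph_def)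
  then obtain x y where exy: "e = {x, y}" "x \<noteq> y" by (auto simp: card_2_iff)
  have k: "lly_curvature V E \<omega> a b = 2 * (\<Sum>x\<in>e. \<omega> e / vertex_weight E \<omega> x) - 2"
    if "e = {a, b}" for a b
  proof -
    have "a \<noteq> b" using that e simple_graph_endpoints(3)[OF G] by auto
    then show ?thesis using lly_curvature_edge[OF G g w, of a b] e that by simp
  qed
  show ?thesis
    unfolding edge_curvature_def
    by (rule the_equality) (use k exy(1) in \<open>auto simp: k\<close>)
qed


section \<open>Incidences of a connected graph\<close>

locale connected_simple_graph =
  fixes V :: "'v set" and E :: "'v set set"
  assumes simple: "simple_graph V E" and connected: "connected_graph V E" and edges: "E \<noteq> {}"
begin

definition incident :: "'v \<Rightarrow> 'v set set" where
  "incident x = {e \<in> E. x \<in> e}"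

definition share :: "('v set \<Rightarrow> real) \<Rightarrow> 'v \<Rightarrow> 'v set \<Rightarrow> real" where
  "share \<omega> x e = \<omega> e / vertex_weight E \<omega> x"

abbreviation vertices_per_edge :: real where
  "vertices_per_edge \<equiv> real (card V) / real (card E)"

text \<open>In girth at least six this is \<open>\<kappa>\<^sub>e\<close> minus its mean value.\<close>

definition excess :: "('v set \<Rightarrow> real) \<Rightarrow> 'v set \<Rightarrow> real" where
  "excess \<omega> e = 2 * (\<Sum>x\<in>e. share \<omega> x e) - 2 * vertices_per_edge"

lemma finite_V: "finite V"
  using simple by (simp add: simple_graph_def)

lemma edge_subset: "e \<in> E \<Longrightarrow> e \<subseteq> V"
  using simple by (simp add: simple_graph_def)

lemma finite_E: "finite E"
  by (rule finite_subset[of _ "Pow V"]) (use edge_subset finite_V in auto)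

lemma finite_edge: "e \<in> E \<Longrightarrow> finite e"
  using edge_subset finite_V finite_subset by blast

lemma finite_incident: "finite (incident x)"
  using finite_E by (simp add: incident_def)

lemma incident_subset: "incident x \<subseteq> E"
  by (auto simp: incident_def)

lemma edge_endpoints:
  assumes "e \<in> E" obtains x y where "e = {x, y}" "x \<noteq> y"
proof -
  have "card e = 2" using simple assms by (simp add: simple_graph_def)
  then show ?thesis using that by (auto simp: card_2_iff)
qed

lemma card_E_pos: "0 < card E"
  using finite_E edges by (simp add: card_gt_0_iff)

lemma edge_leaving:
  assumes "\<Omega> \<subseteq> V" "\<Omega> \<noteq> {}" "\<Omega> \<noteq> V"
  shows "\<exists>x y. {x, y} \<in> E \<and> x \<in> \<Omega> \<and> y \<notin> \<Omega>"
proof (rule ccontr)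
  assume no: "\<not> ?thesis"
  obtain u v where uv: "u \<in> \<Omega>" "v \<in> V" "v \<notin> \<Omega>" using assms by blast
  then obtain p where p: "walk_betw E u p v"
    using connected assms(1) unfolding connected_graph_def by blast
  have "last q \<in> \<Omega>" if "q \<noteq> []" "hd q \<in> \<Omega>" "successively (\<lambda>x y. {x, y} \<in> E) q" for q
    using that
  proof (induction q rule: list_nonempty_induct)
    case (cons x xs)
    then show ?case using no by (auto simp: successively_Cons)
  qed auto
  then show False using p uv by (auto simp: walk_betw_def)
qed

lemma incident_nonempty:
  assumes "x \<in> V" shows "incident x \<noteq> {}"
proof -
  obtain e where "e \<in> E" using edges by blast
  then obtain a b where "e = {a, b}" "a \<noteq> b" "a \<in> V" "b \<in> V"
    using edge_endpoints edge_subset by (metis insert_subset)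
  then have "{x} \<noteq> V" by auto
  then obtain y where "{x, y} \<in> E" using edge_leaving[of "{x}"] assms by auto
  then show ?thesis by (auto simp: incident_def)
qed

lemma vertex_weight_incident: "vertex_weight E \<omega> x = (\<Sum>e\<in>incident x. \<omega> e)"
  unfolding vertex_weight_def
proof (rule sum.reindex_bij_betw)
  show "bij_betw (\<lambda>y. {x, y}) {y. {x, y} \<in> E} (incident x)"
  proof (rule bij_betwI')
    fix e assume e: "e \<in> incident x"
    then obtain a b where "e = {a, b}" by (auto simp: incident_def elim: edge_endpoints)
    then show "\<exists>y\<in>{y. {x, y} \<in> E}. e = {x, y}"
      using e by (auto simp: incident_def insert_commute)
  qed (auto simp: incident_def doubleton_eq_iff)
qed

lemma sum_incidences:
  "(\<Sum>x\<in>V. \<Sum>e\<in>incident x. g x e) = (\<Sum>e\<in>E. \<Sum>x\<in>e. g x e)"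
proof -
  have "(\<Sum>x\<in>V. \<Sum>e\<in>incident x. g x e) = (\<Sum>e\<in>E. \<Sum>x | x \<in> V \<and> x \<in> e. g x e)"
    unfolding incident_def by (rule sum.swap_restrict[OF finite_V finite_E])
  also have "\<dots> = (\<Sum>e\<in>E. \<Sum>x\<in>e. g x e)"
    by (intro sum.cong refl) (use edge_subset in auto)
  finally show ?thesis .
qed

lemma vertex_weight_positive:
  assumes "positive_weight E \<omega>" "x \<in> V"
  shows "0 < vertex_weight E \<omega> x"
  unfolding vertex_weight_incident
  by (rule sum_pos[OF finite_incident incident_nonempty[OF assms(2)]])
    (use assms in \<open>auto simp: positive_weight_def incident_def\<close>)

lemma share_positive:
  assumes "positive_weight E \<omega>" "x \<in> V" "e \<in> E"
  shows "0 < share \<omega> x e"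
  using vertex_weight_positive[OF assms(1,2)] assms
  by (simp add: share_def positive_weight_def)

lemma sum_share:
  assumes "positive_weight E \<omega>" "x \<in> V"
  shows "(\<Sum>e\<in>incident x. share \<omega> x e) = 1"
  using vertex_weight_positive[OF assms]
  by (simp add: share_def vertex_weight_incident flip: sum_divide_distrib)

lemma sum_excess:
  assumes "positive_weight E \<omega>"
  shows "(\<Sum>e\<in>E. excess \<omega> e) = 0"
proof -
  have "(\<Sum>e\<in>E. \<Sum>x\<in>e. share \<omega> x e) = real (card V)"
    unfolding sum_incidences[symmetric] using sum_share[OF assms] by simp
  then show ?thesis
    using card_E_pos by (simp add: excess_def sum_subtractf flip: sum_distrib_left)
qed

lemma edge_curvature_excess:
  assumes "6 \<le> girth E" "positive_weight E \<omega>" "e \<in> E"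
  shows "edge_curvature V E \<omega> e - mean_curvature V E = excess \<omega> e"
  using edge_curvature_girth6[OF simple assms]
  by (simp add: mean_curvature_def excess_def share_def)


section \<open>The density condition\<close>

lemma max_density_condition_iff:
  "max_density_condition V E \<longleftrightarrow>
    (\<forall>\<Omega>. \<Omega> \<noteq> {} \<and> \<Omega> \<subset> V \<longrightarrow>
      real (card (induced_edges E \<Omega>)) * vertices_per_edge < real (card \<Omega>))"
proof -
  let ?S = "{\<Omega>. \<Omega> \<noteq> {} \<and> \<Omega> \<subset> V}"
  obtain e where e: "e \<in> E" using edges by blast
  then obtain a b where ab: "e = {a, b}" "a \<noteq> b" by (rule edge_endpoints)
  have ne: "V \<noteq> {}" using connected by (simp add: connected_graph_def)
  have "{a} \<in> ?S" using ab edge_subset[OF e] by auto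
  then have S: "finite ?S" "?S \<noteq> {}"
    using finite_V by (auto intro: finite_subset[of _ "Pow V"])
  have pos: "0 < real (card V)" "0 < real (card E)"
    using ne finite_V card_E_pos by (auto simp: card_gt_0_iff)
  have "real (card (induced_edges E \<Omega>)) / real (card \<Omega>) < real (card E) / real (card V) \<longleftrightarrow>
      real (card (induced_edges E \<Omega>)) * vertices_per_edge < real (card \<Omega>)" if "\<Omega> \<in> ?S" for \<Omega>
  proof -
    have "0 < real (card \<Omega>)"
      using that finite_V finite_subset by (auto simp: card_gt_0_iff)
    then show ?thesis using pos by (simp add: field_simps)
  qed
  then show ?thesis
    unfolding max_density_condition_def using S by (subst Max_less_iff) auto
qed

text \<open>
  At constant curvature every edge carries the same total share \<open>|V|/|E|\<close> at its two ends. The edges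
  inside \<open>\<Omega>\<close> take all these shares from vertices of \<open>\<Omega>\<close>, each of which has only \<open>1\<close> to give, and
  some vertex of \<open>\<Omega>\<close> also spends a positive share on an edge that leaves \<open>\<Omega>\<close>.
\<close>

lemma constant_curvature_imp_density:
  assumes w: "positive_weight E \<eta>" and k: "\<And>e. e \<in> E \<Longrightarrow> excess \<eta> e = 0"
  shows "max_density_condition V E"
  unfolding max_density_condition_iff
proof (intro allI impI)
  fix \<Omega> assume "\<Omega> \<noteq> {} \<and> \<Omega> \<subset> V"
  then have \<Omega>: "\<Omega> \<subseteq> V" "\<Omega> \<noteq> {}" "\<Omega> \<noteq> V" by auto
  let ?A = "induced_edges E \<Omega>"
  have fin: "finite \<Omega>" using \<Omega> finite_V finite_subset by blast
  have A: "finite ?A" "?A \<subseteq> E" using finite_E by (auto simp: induced_edges_def)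
  have "(\<Sum>x\<in>e. share \<eta> x e) = vertices_per_edge" if "e \<in> ?A" for e
    using k[of e] A that by (auto simp: excess_def)
  then have "real (card ?A) * vertices_per_edge = (\<Sum>e\<in>?A. \<Sum>x\<in>e. share \<eta> x e)"
    by simp
  also have "\<dots> = (\<Sum>e\<in>?A. \<Sum>x | x \<in> \<Omega> \<and> x \<in> e. share \<eta> x e)"
    by (intro sum.cong refl) (auto simp: induced_edges_def)
  also have "\<dots> = (\<Sum>x\<in>\<Omega>. \<Sum>e | e \<in> ?A \<and> x \<in> e. share \<eta> x e)"
    by (rule sum.swap_restrict[OF fin A(1), symmetric])
  also have "\<dots> < (\<Sum>x\<in>\<Omega>. \<Sum>e\<in>incident x. share \<eta> x e)"
  proof (rule sum_strict_mono_ex1[OF fin])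
    have sub: "{e. e \<in> ?A \<and> x \<in> e} \<subseteq> incident x" for x
      by (auto simp: induced_edges_def incident_def)
    have sh: "0 < share \<eta> x e" if "x \<in> \<Omega>" "e \<in> incident x" for x e
      using share_positive[OF w] that \<Omega> incident_subset by blast
    show "\<forall>x\<in>\<Omega>. (\<Sum>e | e \<in> ?A \<and> x \<in> e. share \<eta> x e) \<le> (\<Sum>e\<in>incident x. share \<eta> x e)"
      by (intro ballI sum_mono2 finite_incident sub) (use sh in \<open>auto intro: less_imp_le\<close>)
    obtain x y where xy: "{x, y} \<in> E" "x \<in> \<Omega>" "y \<notin> \<Omega>" using edge_leaving[OF \<Omega>] by blast
    show "\<exists>x\<in>\<Omega>. (\<Sum>e | e \<in> ?A \<and> x \<in> e. share \<eta> x e) < (\<Sum>e\<in>incident x. share \<eta> x e)"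
    proof (rule bexI[OF _ xy(2)], rule sum_strict_mono2[OF finite_incident sub])
      show "{x, y} \<in> incident x - {e. e \<in> ?A \<and> x \<in> e}"
        using xy by (auto simp: incident_def induced_edges_def)
      then show "0 < share \<eta> x {x, y}" using sh xy by blast
    qed (use sh xy in \<open>auto intro: less_imp_le\<close>)
  qed
  also have "\<dots> = real (card \<Omega>)" using sum_share[OF w] \<Omega>(1) by (simp add: subset_iff)
  finally show "real (card ?A) * vertices_per_edge < real (card \<Omega>)" .
qed

text \<open>
  The density condition speaks of induced edge sets. The layer-cake argument needs it for all proper edge
  sets \<open>A\<close>: pass to the edges induced by \<open>\<Union>A\<close>, or, if \<open>A\<close> covers \<open>V\<close>, use that \<open>A\<close> has fewer edges than \<open>E\<close>.
\<close>

lemma density_imp_covered_vertices: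
  assumes d: "max_density_condition V E" and A: "A \<subset> E" "A \<noteq> {}"
  shows "real (card A) * vertices_per_edge < real (card (\<Union>A))"
proof (cases "\<Union>A = V")
  case True
  have "card A < card E" using A finite_E by (simp add: psubset_card_mono)
  moreover have "0 < card V"
    using finite_V connected by (simp add: connected_graph_def card_gt_0_iff)
  ultimately show ?thesis using True card_E_pos by (simp add: field_simps)
next
  case False
  have sub: "\<Union>A \<subseteq> V" using A edge_subset by blast
  obtain e where e: "e \<in> A" using A by blast
  moreover have "e \<noteq> {}" using A e edge_endpoints[of e] by blast
  ultimately have "\<Union>A \<noteq> {}" by blast
  then have *: "real (card (induced_edges E (\<Union>A))) * vertices_per_edge < real (card (\<Union>A))"
    using d[unfolded max_density_condition_iff, rule_format, of "\<Union>A"] False sub by simp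
  have "card A \<le> card (induced_edges E (\<Union>A))"
    by (rule card_mono) (use A finite_E in \<open>auto simp: induced_edges_def\<close>)
  then have "real (card A) * vertices_per_edge \<le> real (card (induced_edges E (\<Union>A))) * vertices_per_edge"
    by (intro mult_right_mono) auto
  with * show ?thesis by linarith
qed

lemma has_integral_step:
  assumes "a \<le> v" "v \<le> b"
  shows "((\<lambda>s. if s \<le> v then 1 else 0 :: real) has_integral (v - a)) {a..b}"
proof -
  have "((\<lambda>s. if s \<in> {a..v} then 1 else 0 :: real) has_integral (v - a)) {a..b}"
    using has_integral_const_real[of "1::real" a v] assms
    by (subst has_integral_restrict) auto
  then show ?thesis by (rule has_integral_eq[rotated]) auto
qed

text \<open>
  The recession function of the energy of the flow is coercive modulo constants. By the layer-cake
  formula it is the integral over levels \<open>s\<close> of the number of vertices covered by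
  \<open>A = {e. s \<le> u e}\<close> minus \<open>|A| |V|/|E|\<close>. For a proper nonempty edge set this difference is positive by the
  density condition, hence at least a uniform \<open>\<delta>\<close>; it vanishes for \<open>A = E\<close>, the case of the single
  level \<open>s = min u\<close> of the range.
\<close>

lemma density_imp_coercive:
  assumes d: "max_density_condition V E"
  obtains \<delta> where "0 < \<delta>"
    and "\<And>u e f. e \<in> E \<Longrightarrow> f \<in> E \<Longrightarrow>
      \<delta> * (u e - u f) \<le> (\<Sum>x\<in>V. Max (u ` incident x)) - vertices_per_edge * (\<Sum>e\<in>E. u e)"
proof -
  define gap where "gap A = real (card (\<Union>A)) - real (card A) * vertices_per_edge" for A :: "'v set set"
  \<comment> \<open>The element 1 only keeps the set nonempty when the graph is a single edge.\<close>
  define \<delta> where "\<delta> = Min (insert 1 (gap ` {A. A \<subset> E \<and> A \<noteq> {}}))"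
  have fin: "finite (insert 1 (gap ` {A. A \<subset> E \<and> A \<noteq> {}}))"
    using finite_E by (auto intro: finite_subset[of _ "Pow E"])
  have \<delta>: "0 < \<delta>"
    unfolding \<delta>_def using fin density_imp_covered_vertices[OF d]
    by (subst Min_gr_iff) (auto simp: gap_def)
  have \<delta>_le: "\<delta> \<le> gap A" if "A \<subset> E" "A \<noteq> {}" for A
    unfolding \<delta>_def using fin that by (intro Min_le) auto
  have gapE: "gap E = 0"
  proof -
    have "\<Union>E = V"
    proof
      show "V \<subseteq> \<Union>E"
      proof
        fix x assume "x \<in> V"
        then obtain e where "e \<in> incident x" using incident_nonempty by blast
        then show "x \<in> \<Union>E" by (auto simp: incident_def)
      qed
    qed (use edge_subset in blast)
    then show ?thesis using card_E_pos by (simp add: gap_def)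
  qed
  have "\<delta> * (u e - u f) \<le> (\<Sum>x\<in>V. Max (u ` incident x)) - vertices_per_edge * (\<Sum>e\<in>E. u e)"
    if e: "e \<in> E" and f: "f \<in> E" for u :: "'v set \<Rightarrow> real" and e f
  proof -
    define a where "a = Min (u ` E)"
    define b where "b = Max (u ` E)"
    let ?step = "\<lambda>v s. if s \<le> v then 1 else 0 :: real"
    let ?M = "\<lambda>x. Max (u ` incident x)"
    have ab: "a \<le> u e'" "u e' \<le> b" if "e' \<in> E" for e'
      using that finite_E by (auto simp: a_def b_def)
    have "a \<le> b" using ab[OF e] by linarith
    have M: "a \<le> ?M x" "?M x \<le> b" if x: "x \<in> V" for x
    proof -
      have "?M x \<in> u ` incident x"
        using finite_incident incident_nonempty[OF x] by (intro Max_in) auto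
      then show "a \<le> ?M x" "?M x \<le> b" using ab subsetD[OF incident_subset] by auto
    qed
    have R: "((\<lambda>s. (\<Sum>x\<in>V. ?step (?M x) s) - vertices_per_edge * (\<Sum>e\<in>E. ?step (u e) s))
        has_integral (\<Sum>x\<in>V. ?M x - a) - vertices_per_edge * (\<Sum>e\<in>E. u e - a)) {a..b}"
      by (intro has_integral_diff has_integral_sum has_integral_mult_right has_integral_step
          finite_V finite_E ab M)
    \<comment> \<open>The integrand is \<open>\<delta>\<close> except at \<open>s = a\<close>, where it is zero like the one above.\<close>
    have L: "((\<lambda>s. \<delta> * (?step b s - ?step a s)) has_integral \<delta> * ((b - a) - (a - a))) {a..b}"
      by (intro has_integral_diff has_integral_mult_right has_integral_step) (use \<open>a \<le> b\<close> in auto)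
    have "\<delta> * ((b - a) - (a - a)) \<le> (\<Sum>x\<in>V. ?M x - a) - vertices_per_edge * (\<Sum>e\<in>E. u e - a)"
    proof (rule has_integral_le[OF L R])
      fix s assume s: "s \<in> {a..b}"
      define A where "A = {e \<in> E. s \<le> u e}"
      have "{x \<in> V. s \<le> ?M x} = \<Union>A"
      proof (intro set_eqI)
        fix x
        have "s \<le> ?M x \<longleftrightarrow> (\<exists>e\<in>incident x. s \<le> u e)" if "x \<in> V"
          using finite_incident incident_nonempty[OF that] by (subst Max_ge_iff) auto
        then show "x \<in> {x \<in> V. s \<le> ?M x} \<longleftrightarrow> x \<in> \<Union>A"
          using edge_subset by (auto simp: A_def incident_def)
      qed
      then have "(\<Sum>x\<in>V. ?step (?M x) s) = real (card (\<Union>A))"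
        using finite_V by (simp add: sum.If_cases Int_def)
      moreover have "(\<Sum>e\<in>E. ?step (u e) s) = real (card A)"
        using finite_E by (simp add: A_def sum.If_cases Int_def)
      ultimately have eq: "(\<Sum>x\<in>V. ?step (?M x) s) - vertices_per_edge * (\<Sum>e\<in>E. ?step (u e) s) = gap A"
        by (simp add: gap_def)
      have "b \<in> u ` E" unfolding b_def using finite_E edges by (intro Max_in) auto
      then have ne: "A \<noteq> {}" using s by (auto simp: A_def)
      have "a \<in> u ` E" unfolding a_def using finite_E edges by (intro Min_in) auto
      then obtain e\<^sub>0 where "e\<^sub>0 \<in> E" "u e\<^sub>0 = a" by auto
      then have "e\<^sub>0 \<in> E - A" if "a < s" using that by (simp add: A_def)
      then have "A \<noteq> E" if "a < s" using that by blast
      moreover have "A \<subseteq> E" by (auto simp: A_def)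
      moreover have "A = E" if "s \<le> a"
        unfolding A_def using order_trans[OF that ab(1)] by blast
      ultimately have "\<delta> * (?step b s - ?step a s) \<le> gap A"
        using \<delta>_le[of A] ne s gapE by (cases "s \<le> a") auto
      then show "\<delta> * (?step b s - ?step a s)
          \<le> (\<Sum>x\<in>V. ?step (?M x) s) - vertices_per_edge * (\<Sum>e\<in>E. ?step (u e) s)"
        unfolding eq .
    qed
    moreover have "\<delta> * (u e - u f) \<le> \<delta> * (b - a)"
      using ab[OF e] ab[OF f] \<delta> by (intro mult_left_mono) auto
    moreover have "(\<Sum>x\<in>V. ?M x - a) - vertices_per_edge * (\<Sum>e\<in>E. u e - a)
        = (\<Sum>x\<in>V. ?M x) - vertices_per_edge * (\<Sum>e\<in>E. u e)"
      using card_E_pos by (simp add: sum_subtractf field_simps)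
    ultimately show ?thesis by simp
  qed
  with \<delta> that show thesis by blast
qed


section \<open>A Poincare inequality on incidences\<close>

text \<open>
  If each edge value is close to the values at its two ends then, along walks, all edge values are
  close to each other; with zero sum they are then close to zero.
\<close>

lemma poincare_incidences:
  obtains C where "0 < C"
    and "\<And>(k :: 'v set \<Rightarrow> real) (a :: 'v \<Rightarrow> real). (\<Sum>e\<in>E. k e) = 0 \<Longrightarrow>
      (\<Sum>e\<in>E. (k e)\<^sup>2) \<le> C * (\<Sum>x\<in>V. \<Sum>e\<in>incident x. (k e - a x)\<^sup>2)"
proof -
  have "\<exists>len. \<forall>u\<in>V. \<forall>v\<in>V. \<exists>p. walk_betw E u p v \<and> length p = len u v"
  proof -
    have "\<forall>u v. \<exists>n. u \<in> V \<longrightarrow> v \<in> V \<longrightarrow> (\<exists>p. walk_betw E u p v \<and> length p = n)"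
      using connected by (auto simp: connected_graph_def)
    then show ?thesis by (simp only: choice_iff) blast
  qed
  then obtain len where len: "\<And>u v. u \<in> V \<Longrightarrow> v \<in> V \<Longrightarrow> \<exists>p. walk_betw E u p v \<and> length p = len u v"
    by blast
  define N where "N = (\<Sum>u\<in>V. \<Sum>v\<in>V. len u v)"
  have N: "len u v \<le> N" if "u \<in> V" "v \<in> V" for u v
  proof -
    have "len u v \<le> (\<Sum>v\<in>V. len u v)" by (rule member_le_sum) (use that finite_V in auto)
    also have "\<dots> \<le> N"
      unfolding N_def by (rule member_le_sum[where f="\<lambda>u. \<Sum>v\<in>V. len u v"]) (use that finite_V in auto)
    finally show ?thesis .
  qed
  define B where "B = 2 * real N + 2"
  have B: "0 < B" by (simp add: B_def)
  have "(\<Sum>e\<in>E. (k e)\<^sup>2) \<le> (real (card E) * B\<^sup>2) * (\<Sum>x\<in>V. \<Sum>e\<in>incident x. (k e - a x)\<^sup>2)"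
    if k: "(\<Sum>e\<in>E. k e) = 0" for k :: "'v set \<Rightarrow> real" and a :: "'v \<Rightarrow> real"
  proof -
    define D where "D = (\<Sum>x\<in>V. \<Sum>e\<in>incident x. (k e - a x)\<^sup>2)"
    have D0: "0 \<le> D" unfolding D_def by (intro sum_nonneg) auto
    have near: "\<bar>k e - a x\<bar> \<le> sqrt D" if "e \<in> E" "x \<in> e" for e x
    proof -
      have "(k e - a x)\<^sup>2 \<le> (\<Sum>e\<in>incident x. (k e - a x)\<^sup>2)"
        by (rule member_le_sum[where f="\<lambda>e. (k e - a x)\<^sup>2"])
          (use that finite_incident in \<open>auto simp: incident_def\<close>)
      also have "\<dots> \<le> D"
        unfolding D_def
        by (rule member_le_sum[where f="\<lambda>x. \<Sum>e\<in>incident x. (k e - a x)\<^sup>2"])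
          (use that edge_subset finite_V in \<open>auto intro!: sum_nonneg\<close>)
      finally show ?thesis by (metis real_le_rsqrt power2_abs)
    qed
    have walk: "\<bar>a (hd p) - a (last p)\<bar> \<le> 2 * real (length p) * sqrt D"
      if "p \<noteq> []" "successively (\<lambda>x y. {x, y} \<in> E) p" for p
      using that
    proof (induction p rule: list_nonempty_induct)
      case (single x)
      then show ?case using D0 by simp
    next
      case (cons x xs)
      then have e: "{x, hd xs} \<in> E" and IH: "\<bar>a (hd xs) - a (last xs)\<bar> \<le> 2 * real (length xs) * sqrt D"
        by (auto simp: successively_Cons)
      have "\<bar>a x - a (hd xs)\<bar> \<le> 2 * sqrt D"
        using near[OF e, of x] near[OF e, of "hd xs"] by auto
      with IH have "\<bar>a x - a (last xs)\<bar> \<le> 2 * sqrt D + 2 * real (length xs) * sqrt D" by linarith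
      then show ?case using cons by (simp add: algebra_simps)
    qed
    have diff: "\<bar>k e - k f\<bar> \<le> B * sqrt D" if e: "e \<in> E" and f: "f \<in> E" for e f
    proof -
      obtain x y where xy: "x \<in> e" "y \<in> f" using e f by (metis edge_endpoints insertI1)
      then have "x \<in> V" "y \<in> V" using edge_subset e f by auto
      then obtain p where p: "walk_betw E x p y" "length p \<le> N" using len N by metis
      then have "\<bar>a x - a y\<bar> \<le> 2 * real (length p) * sqrt D"
        using walk[of p] by (auto simp: walk_betw_def)
      also have "\<dots> \<le> 2 * real N * sqrt D"
        using p D0 by (intro mult_right_mono) auto
      finally show ?thesis
        using near[OF e xy(1)] near[OF f xy(2)] by (simp add: B_def algebra_simps)
    qed
    have bound: "(k e)\<^sup>2 \<le> B\<^sup>2 * D" if e: "e \<in> E" for e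
    proof -
      have "real (card E) * k e = (\<Sum>f\<in>E. k e - k f)" using k by (simp add: sum_subtractf)
      also have "\<bar>\<dots>\<bar> \<le> (\<Sum>f\<in>E. \<bar>k e - k f\<bar>)" by (rule sum_abs)
      also have "\<dots> \<le> (\<Sum>f\<in>E. B * sqrt D)" by (intro sum_mono diff e)
      finally have "real (card E) * \<bar>k e\<bar> \<le> real (card E) * (B * sqrt D)" by (simp add: abs_mult)
      then have "\<bar>k e\<bar> \<le> B * sqrt D" using card_E_pos by simp
      then have "\<bar>k e\<bar>\<^sup>2 \<le> (B * sqrt D)\<^sup>2" by (intro power_mono) auto
      then show ?thesis using D0 by (simp add: power_mult_distrib)
    qed
    have "(\<Sum>e\<in>E. (k e)\<^sup>2) \<le> (\<Sum>e\<in>E. B\<^sup>2 * D)" by (intro sum_mono bound)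
    then show ?thesis by (simp add: D_def)
  qed
  moreover have "0 < real (card E) * B\<^sup>2" using B card_E_pos by simp
  ultimately show thesis using that by blast
qed

end


section \<open>Monotone and exponentially convergent functions on the half line\<close>

lemma nonincreasing_half_line:
  fixes f :: "real \<Rightarrow> real"
  assumes d: "\<And>t. 0 \<le> t \<Longrightarrow> (f has_real_derivative f' t) (at t within {0..})"
    and le: "\<And>t. 0 \<le> t \<Longrightarrow> f' t \<le> 0"
    and st: "0 \<le> s" "s \<le> t"
  shows "f t \<le> f s"
proof -
  have "\<exists>x\<in>{s..t}. f t - f s = f' x * (t - s)"
  proof (rule mvt_very_simple[OF st(2), where f'="\<lambda>x h. f' x * h"])
    fix x assume x: "s \<le> x" "x \<le> t"
    have "(f has_real_derivative f' x) (at x within {s..t})"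
      by (rule has_field_derivative_subset[OF d]) (use x st in auto)
    then show "(f has_derivative (\<lambda>h. f' x * h)) (at x within {s..t})"
      by (simp add: has_field_derivative_def)
  qed
  then obtain x where "x \<in> {s..t}" "f t - f s = f' x * (t - s)" by blast
  moreover from this have "f' x * (t - s) \<le> 0"
    using le[of x] st by (intro mult_nonpos_nonneg) auto
  ultimately show ?thesis by linarith
qed

lemma gronwall_half_line:
  fixes f :: "real \<Rightarrow> real"
  assumes d: "\<And>t. 0 \<le> t \<Longrightarrow> (f has_real_derivative f' t) (at t within {0..})"
    and le: "\<And>t. 0 \<le> t \<Longrightarrow> f' t \<le> - r * f t"
    and t: "0 \<le> t"
  shows "f t \<le> f 0 * exp (- r * t)"
proof -
  have "f t * exp (r * t) \<le> f 0 * exp (r * 0)"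
  proof (rule nonincreasing_half_line[where f="\<lambda>t. f t * exp (r * t)"
        and f'="\<lambda>t. f' t * exp (r * t) + f t * (r * exp (r * t))"])
    fix s :: real assume s: "0 \<le> s"
    show "((\<lambda>t. f t * exp (r * t)) has_real_derivative
        f' s * exp (r * s) + f s * (r * exp (r * s))) (at s within {0..})"
      by (auto intro!: derivative_eq_intros d s)
    have "(f' s + r * f s) * exp (r * s) \<le> 0"
      using le[OF s] by (intro mult_nonpos_nonneg) auto
    then show "f' s * exp (r * s) + f s * (r * exp (r * s)) \<le> 0" by (simp add: algebra_simps)
  qed (use t in auto)
  then show ?thesis by (simp add: exp_minus field_simps)
qed

text \<open>
  With \<open>|f'| \<le> C exp (-r t)\<close>, the functions \<open>f - (C/r) exp (-r t)\<close> and \<open>f + (C/r) exp (-r t)\<close> are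
  monotone in opposite directions, and the limit is the number that separates them.
\<close>

lemma exponential_limit_half_line:
  fixes f :: "real \<Rightarrow> real"
  assumes d: "\<And>t. 0 \<le> t \<Longrightarrow> (f has_real_derivative f' t) (at t within {0..})"
    and le: "\<And>t. 0 \<le> t \<Longrightarrow> \<bar>f' t\<bar> \<le> C * exp (- r * t)" and r: "0 < r"
  obtains L where "\<And>t. 0 \<le> t \<Longrightarrow> \<bar>f t - L\<bar> \<le> C / r * exp (- r * t)"
proof -
  define lo where "lo t = f t - C / r * exp (- r * t)" for t
  define hi where "hi t = f t + C / r * exp (- r * t)" for t
  have "0 \<le> C * exp (- r * 0)" using le[of 0] by (rule order_trans[OF abs_ge_zero]) simp
  then have C: "0 \<le> C" by simp
  have hi: "hi t \<le> hi s" if "0 \<le> s" "s \<le> t" for s t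
  proof (rule nonincreasing_half_line[OF _ _ that])
    fix t :: real assume t: "0 \<le> t"
    show "(hi has_real_derivative f' t - C * exp (- r * t)) (at t within {0..})"
      unfolding hi_def using r by (auto intro!: derivative_eq_intros d t)
    show "f' t - C * exp (- r * t) \<le> 0" using le[OF t] by linarith
  qed
  have "- lo t \<le> - lo s" if "0 \<le> s" "s \<le> t" for s t
  proof (rule nonincreasing_half_line[OF _ _ that])
    fix t :: real assume t: "0 \<le> t"
    show "((\<lambda>t. - lo t) has_real_derivative - f' t - C * exp (- r * t)) (at t within {0..})"
      unfolding lo_def using r by (auto intro!: derivative_eq_intros d t)
    show "- f' t - C * exp (- r * t) \<le> 0" using le[OF t] by linarith
  qed
  then have lo: "lo s \<le> lo t" if "0 \<le> s" "s \<le> t" for s t using that by fastforce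
  have lo_hi: "lo s \<le> hi t" if "0 \<le> s" "0 \<le> t" for s t
  proof -
    have "lo s \<le> lo (max s t)" by (rule lo) (use that in auto)
    also have "\<dots> \<le> hi (max s t)" using C r by (simp add: lo_def hi_def)
    also have "\<dots> \<le> hi t" by (rule hi) (use that in auto)
    finally show ?thesis .
  qed
  define L where "L = (SUP s\<in>{0..}. lo s)"
  have "\<bar>f t - L\<bar> \<le> C / r * exp (- r * t)" if t: "0 \<le> t" for t
  proof -
    have "lo t \<le> L"
      unfolding L_def by (rule cSUP_upper) (use t lo_hi[OF _ t] in \<open>auto intro!: bdd_aboveI2\<close>)
    moreover have "L \<le> hi t"
      unfolding L_def by (rule cSUP_least) (use t lo_hi[OF _ t] in auto)
    ultimately show ?thesis by (auto simp: lo_def hi_def)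
  qed
  then show thesis using that by blast
qed

lemma tendsto_of_exponential_bound:
  fixes f :: "real \<Rightarrow> real"
  assumes b: "\<And>t. 0 \<le> t \<Longrightarrow> \<bar>f t - L\<bar> \<le> C * exp (- r * t)" and r: "0 < r"
  shows "(f \<longlongrightarrow> L) at_top"
proof -
  have "filterlim (\<lambda>t. r * t) at_top at_top"
    by (rule filterlim_tendsto_pos_mult_at_top[OF tendsto_const r filterlim_ident])
  then have "((\<lambda>t. exp (- (r * t))) \<longlongrightarrow> 0) at_top"
    by (intro filterlim_compose[OF exp_at_bot] filterlim_compose[OF filterlim_uminus_at_bot_at_top])
  from tendsto_mult_right_zero[OF this, of C]
  have "((\<lambda>t. f t - L) \<longlongrightarrow> 0) at_top"
  proof (rule Lim_null_comparison[rotated])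
    show "\<forall>\<^sub>F t in at_top. norm (f t - L) \<le> C * exp (- (r * t))"
      using eventually_ge_at_top[of 0] by eventually_elim (use b in simp)
  qed
  then show ?thesis by (simp add: LIM_zero_iff)
qed


section \<open>The normalized flow\<close>

locale normalized_flow = connected_simple_graph V E
  for V :: "'v set" and E :: "'v set set" +
  fixes \<omega> :: "real \<Rightarrow> 'v set \<Rightarrow> real"
  assumes positive: "\<And>t. 0 \<le> t \<Longrightarrow> positive_weight E (\<omega> t)"
    and flow: "\<And>t e. 0 \<le> t \<Longrightarrow> e \<in> E \<Longrightarrow>
      ((\<lambda>s. \<omega> s e) has_real_derivative - excess (\<omega> t) e * \<omega> t e) (at t within {0..})"
begin

definition mean_excess :: "real \<Rightarrow> 'v \<Rightarrow> real" where
  "mean_excess t x = (\<Sum>e\<in>incident x. share (\<omega> t) x e * excess (\<omega> t) e)"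

definition energy :: "real \<Rightarrow> real" where
  "energy t = (\<Sum>x\<in>V. ln (vertex_weight E (\<omega> t) x)) - vertices_per_edge * (\<Sum>e\<in>E. ln (\<omega> t e))"

lemma edge_pos: "0 \<le> t \<Longrightarrow> e \<in> E \<Longrightarrow> 0 < \<omega> t e"
  using positive by (simp add: positive_weight_def)

lemma vertex_pos: "0 \<le> t \<Longrightarrow> x \<in> V \<Longrightarrow> 0 < vertex_weight E (\<omega> t) x"
  using positive vertex_weight_positive by blast

lemma vertex_weight_derivative:
  assumes t: "0 \<le> t" and x: "x \<in> V"
  shows "((\<lambda>s. vertex_weight E (\<omega> s) x) has_real_derivative
    - mean_excess t x * vertex_weight E (\<omega> t) x) (at t within {0..})"
proof -
  have "((\<lambda>s. vertex_weight E (\<omega> s) x) has_real_derivative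
      (\<Sum>e\<in>incident x. - excess (\<omega> t) e * \<omega> t e)) (at t within {0..})"
    unfolding vertex_weight_incident
    by (intro DERIV_sum flow t) (use incident_subset in blast)
  also have "(\<Sum>e\<in>incident x. - excess (\<omega> t) e * \<omega> t e)
      = (\<Sum>e\<in>incident x. - (share (\<omega> t) x e * excess (\<omega> t) e * vertex_weight E (\<omega> t) x))"
    by (intro sum.cong refl) (use vertex_pos[OF t x] in \<open>simp add: share_def\<close>)
  also have "\<dots> = - mean_excess t x * vertex_weight E (\<omega> t) x"
    by (simp add: mean_excess_def sum_distrib_right sum_negf)
  finally show ?thesis .
qed

lemma share_derivative:
  assumes t: "0 \<le> t" and e: "e \<in> E" and x: "x \<in> e"
  shows "((\<lambda>s. share (\<omega> s) x e) has_real_derivative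
    - share (\<omega> t) x e * (excess (\<omega> t) e - mean_excess t x)) (at t within {0..})"
proof -
  have xV: "x \<in> V" using e x edge_subset by blast
  show ?thesis
    unfolding share_def
    by (rule DERIV_cong[OF DERIV_divide[OF flow[OF t e] vertex_weight_derivative[OF t xV]]])
      (use vertex_pos[OF t xV] in \<open>auto simp: field_simps power2_eq_square\<close>)
qed

lemma excess_derivative:
  assumes t: "0 \<le> t" and e: "e \<in> E"
  shows "((\<lambda>s. excess (\<omega> s) e) has_real_derivative
    - 2 * (\<Sum>x\<in>e. share (\<omega> t) x e * (excess (\<omega> t) e - mean_excess t x))) (at t within {0..})"
proof -
  have "((\<lambda>s. 2 * (\<Sum>x\<in>e. share (\<omega> s) x e) - 2 * vertices_per_edge) has_real_derivative
      2 * (\<Sum>x\<in>e. - share (\<omega> t) x e * (excess (\<omega> t) e - mean_excess t x)) - 0) (at t within {0..})"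
    by (intro DERIV_diff DERIV_const DERIV_cmult DERIV_sum share_derivative t e)
  then show ?thesis by (simp add: excess_def sum_negf)
qed

text \<open>
  In the coordinates \<open>ln \<omega>\<close> the flow is twice the negative gradient flow of \<open>energy\<close>, whose Hessian at a
  vector \<open>k\<close> is the sum over the vertices of the variance of \<open>k\<close> with respect to the shares. As \<open>excess\<close> is
  twice the gradient, the squared gradient norm decreases at a rate given by that Hessian.
\<close>

lemma sum_excess_square_derivative:
  assumes t: "0 \<le> t"
  shows "((\<lambda>s. \<Sum>e\<in>E. (excess (\<omega> s) e)\<^sup>2) has_real_derivative
    - 4 * (\<Sum>x\<in>V. \<Sum>e\<in>incident x. share (\<omega> t) x e * (excess (\<omega> t) e - mean_excess t x)\<^sup>2))
    (at t within {0..})"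
proof -
  let ?k = "excess (\<omega> t)" and ?p = "share (\<omega> t)" and ?a = "mean_excess t"
  have "((\<lambda>s. \<Sum>e\<in>E. (excess (\<omega> s) e)\<^sup>2) has_real_derivative
      (\<Sum>e\<in>E. 2 * ?k e * (- 2 * (\<Sum>x\<in>e. ?p x e * (?k e - ?a x))))) (at t within {0..})"
    by (intro DERIV_sum) (auto intro!: derivative_eq_intros excess_derivative t)
  also have "(\<Sum>e\<in>E. 2 * ?k e * (- 2 * (\<Sum>x\<in>e. ?p x e * (?k e - ?a x))))
      = - 4 * (\<Sum>e\<in>E. \<Sum>x\<in>e. ?p x e * (?k e - ?a x) * ?k e)"
    by (simp add: sum_distrib_left sum_distrib_right mult_ac)
  also have "(\<Sum>e\<in>E. \<Sum>x\<in>e. ?p x e * (?k e - ?a x) * ?k e)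
      = (\<Sum>x\<in>V. \<Sum>e\<in>incident x. ?p x e * (?k e - ?a x) * ?k e)"
    by (rule sum_incidences[symmetric])
  also have "\<dots> = (\<Sum>x\<in>V. \<Sum>e\<in>incident x. ?p x e * (?k e - ?a x)\<^sup>2)"
  proof (rule sum.cong[OF refl])
    fix x assume x: "x \<in> V"
    have "(\<Sum>e\<in>incident x. ?p x e * (?k e - ?a x)) = 0"
      using sum_share[OF positive[OF t] x]
      by (simp add: right_diff_distrib sum_subtractf mean_excess_def flip: sum_distrib_right)
    then have "(\<Sum>e\<in>incident x. ?p x e * (?k e - ?a x) * ?a x) = 0"
      by (simp flip: sum_distrib_right)
    moreover have "?p x e * (?k e - ?a x)\<^sup>2
        = ?p x e * (?k e - ?a x) * ?k e - ?p x e * (?k e - ?a x) * ?a x" for e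
      by (simp add: power2_eq_square algebra_simps)
    ultimately show "(\<Sum>e\<in>incident x. ?p x e * (?k e - ?a x) * ?k e)
        = (\<Sum>e\<in>incident x. ?p x e * (?k e - ?a x)\<^sup>2)"
      by (simp add: sum_subtractf)
  qed
  finally show ?thesis .
qed

text \<open>
  The derivative of \<open>energy\<close> in the direction \<open>- excess\<close> is the pairing of this direction with the gradient,
  which is \<open>excess / 2\<close>.
\<close>

lemma energy_derivative:
  assumes t: "0 \<le> t"
  shows "(energy has_real_derivative - (\<Sum>e\<in>E. (excess (\<omega> t) e)\<^sup>2) / 2) (at t within {0..})"
proof -
  let ?k = "excess (\<omega> t)" and ?p = "share (\<omega> t)"
  have "(energy has_real_derivative
      (\<Sum>x\<in>V. - mean_excess t x) - vertices_per_edge * (\<Sum>e\<in>E. - ?k e)) (at t within {0..})"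
    unfolding energy_def
  proof (intro DERIV_diff DERIV_sum DERIV_cmult)
    fix x assume x: "x \<in> V"
    show "((\<lambda>s. ln (vertex_weight E (\<omega> s) x)) has_real_derivative - mean_excess t x) (at t within {0..})"
      using vertex_pos[OF t x]
      by (auto intro!: derivative_eq_intros vertex_weight_derivative t x simp: field_simps)
  next
    fix e assume e: "e \<in> E"
    show "((\<lambda>s. ln (\<omega> s e)) has_real_derivative - ?k e) (at t within {0..})"
      using edge_pos[OF t e] by (auto intro!: derivative_eq_intros flow t e simp: field_simps)
  qed
  moreover have "(\<Sum>x\<in>V. - mean_excess t x) - vertices_per_edge * (\<Sum>e\<in>E. - ?k e)
      = - (\<Sum>e\<in>E. (?k e)\<^sup>2) / 2"
  proof -
    have "(\<Sum>x\<in>V. mean_excess t x) = (\<Sum>e\<in>E. (\<Sum>x\<in>e. ?p x e) * ?k e)"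
      unfolding mean_excess_def by (simp add: sum_incidences sum_distrib_right)
    also have "\<dots> = (\<Sum>e\<in>E. (?k e / 2 + vertices_per_edge) * ?k e)"
      by (simp add: excess_def diff_divide_distrib)
    also have "\<dots> = (\<Sum>e\<in>E. (?k e)\<^sup>2) / 2 + vertices_per_edge * (\<Sum>e\<in>E. ?k e)"
      by (simp add: distrib_right sum.distrib power2_eq_square sum_divide_distrib sum_distrib_left)
    finally show ?thesis by (simp add: sum_negf)
  qed
  ultimately show ?thesis by metis
qed

lemma sum_ln_constant:
  assumes t: "0 \<le> t"
  shows "(\<Sum>e\<in>E. ln (\<omega> t e)) = (\<Sum>e\<in>E. ln (\<omega> 0 e))"
proof -
  let ?S = "\<lambda>s. \<Sum>e\<in>E. ln (\<omega> s e)"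
  have d: "(?S has_real_derivative 0) (at s within {0..})" if s: "0 \<le> s" for s
  proof -
    have "(?S has_real_derivative (\<Sum>e\<in>E. - excess (\<omega> s) e)) (at s within {0..})"
    proof (intro DERIV_sum)
      fix e assume e: "e \<in> E"
      show "((\<lambda>s. ln (\<omega> s e)) has_real_derivative - excess (\<omega> s) e) (at s within {0..})"
        using edge_pos[OF s e] by (auto intro!: derivative_eq_intros flow s e simp: field_simps)
    qed
    then show ?thesis using sum_excess[OF positive[OF s]] by (simp add: sum_negf)
  qed
  have "?S t \<le> ?S 0" by (rule nonincreasing_half_line[where f'="\<lambda>_. 0"]) (use d t in auto)
  moreover have "- ?S t \<le> - ?S 0"
    by (rule nonincreasing_half_line[where f="\<lambda>s. - ?S s" and f'="\<lambda>_. 0"])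
      (use DERIV_minus[OF d] t in auto)
  ultimately show ?thesis by linarith
qed

text \<open>
  Coercivity bounds the oscillation of \<open>ln \<omega>\<close> by the initial energy. The conserved sum of \<open>ln \<omega>\<close> removes the
  remaining freedom of adding a constant.
\<close>

lemma weights_bounded:
  assumes d: "max_density_condition V E"
  obtains K where "\<And>t e. 0 \<le> t \<Longrightarrow> e \<in> E \<Longrightarrow> exp (- K) \<le> \<omega> t e"
    and "\<And>t e. 0 \<le> t \<Longrightarrow> e \<in> E \<Longrightarrow> \<omega> t e \<le> exp K"
proof -
  obtain \<delta> where \<delta>: "0 < \<delta>" and coercive: "\<And>u e f. e \<in> E \<Longrightarrow> f \<in> E \<Longrightarrow>
      \<delta> * (u e - u f) \<le> (\<Sum>x\<in>V. Max (u ` incident x)) - vertices_per_edge * (\<Sum>e\<in>E. u e)"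
    by (rule density_imp_coercive[OF d]) (rule that)
  define S where "S = (\<Sum>e\<in>E. ln (\<omega> 0 e))"
  define B where "B = energy 0 / \<delta>"
  define K where "K = \<bar>S\<bar> + real (card E) * B"
  have K: "\<bar>ln (\<omega> t e)\<bar> \<le> K" if t: "0 \<le> t" and e: "e \<in> E" for t e
  proof -
    let ?u = "\<lambda>e. ln (\<omega> t e)"
    have le: "Max (?u ` incident x) \<le> ln (vertex_weight E (\<omega> t) x)" if x: "x \<in> V" for x
    proof -
      have "?u f \<le> ln (vertex_weight E (\<omega> t) x)" if f: "f \<in> incident x" for f
      proof -
        have fE: "f \<in> E" using f incident_subset by blast
        have "\<omega> t f \<le> vertex_weight E (\<omega> t) x"
          unfolding vertex_weight_incident
          by (rule member_le_sum[OF f _ finite_incident])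
            (use edge_pos[OF t] incident_subset in \<open>auto intro: less_imp_le\<close>)
        then show ?thesis using edge_pos[OF t fE] vertex_pos[OF t x] by simp
      qed
      then show ?thesis using finite_incident incident_nonempty[OF x] by simp
    qed
    have "energy t \<le> energy 0"
      by (rule nonincreasing_half_line[OF energy_derivative _ _ t]) (auto intro: sum_nonneg)
    moreover have "(\<Sum>x\<in>V. Max (?u ` incident x)) - vertices_per_edge * (\<Sum>e\<in>E. ?u e) \<le> energy t"
      unfolding energy_def using sum_mono[OF le] by simp
    ultimately have "\<delta> * (?u f - ?u g) \<le> energy 0" if "f \<in> E" "g \<in> E" for f g
      using coercive[OF that, of ?u] by linarith
    then have "?u f - ?u g \<le> B" if "f \<in> E" "g \<in> E" for f g
      using that \<delta> by (simp add: B_def pos_le_divide_eq mult.commute)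
    then have diff: "\<bar>?u f - ?u g\<bar> \<le> B" if "f \<in> E" "g \<in> E" for f g
      using that by (simp add: abs_le_iff)
    have "real (card E) * ?u e = S + (\<Sum>f\<in>E. ?u e - ?u f)"
      using sum_ln_constant[OF t] by (simp add: S_def sum_subtractf)
    also have "\<bar>\<dots>\<bar> \<le> \<bar>S\<bar> + (\<Sum>f\<in>E. \<bar>?u e - ?u f\<bar>)"
      by (rule order_trans[OF abs_triangle_ineq]) (intro add_left_mono sum_abs)
    also have "(\<Sum>f\<in>E. \<bar>?u e - ?u f\<bar>) \<le> (\<Sum>f\<in>E. B)"
      by (intro sum_mono diff e)
    finally have "real (card E) * \<bar>?u e\<bar> \<le> K" by (simp add: K_def abs_mult)
    moreover have "1 * \<bar>?u e\<bar> \<le> real (card E) * \<bar>?u e\<bar>"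
      using card_E_pos by (intro mult_right_mono) auto
    ultimately show ?thesis by linarith
  qed
  show thesis
  proof (rule that)
    fix t e assume te: "0 \<le> (t::real)" "e \<in> E"
    have "exp (- K) \<le> exp (ln (\<omega> t e))" "exp (ln (\<omega> t e)) \<le> exp K"
      using K[OF te] by auto
    then show "exp (- K) \<le> \<omega> t e" "\<omega> t e \<le> exp K" using edge_pos[OF te] by auto
  qed
qed

lemma shares_bounded_below:
  assumes d: "max_density_condition V E"
  obtains p\<^sub>0 where "0 < p\<^sub>0"
    and "\<And>t x e. 0 \<le> t \<Longrightarrow> x \<in> V \<Longrightarrow> e \<in> incident x \<Longrightarrow> p\<^sub>0 \<le> share (\<omega> t) x e"
proof -
  obtain K where bnd: "\<And>t e. 0 \<le> t \<Longrightarrow> e \<in> E \<Longrightarrow> exp (- K) \<le> \<omega> t e"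
      "\<And>t e. 0 \<le> t \<Longrightarrow> e \<in> E \<Longrightarrow> \<omega> t e \<le> exp K"
    by (rule weights_bounded[OF d]) (rule that)
  have "exp (- K) / (real (card E) * exp K) \<le> share (\<omega> t) x e"
    if t: "0 \<le> t" and x: "x \<in> V" and e: "e \<in> incident x" for t x e
  proof -
    have "vertex_weight E (\<omega> t) x \<le> (\<Sum>e\<in>E. \<omega> t e)"
      unfolding vertex_weight_incident
      by (intro sum_mono2 finite_E incident_subset) (use edge_pos[OF t] in \<open>auto intro: less_imp_le\<close>)
    also have "\<dots> \<le> (\<Sum>e\<in>E. exp K)" by (intro sum_mono bnd t)
    finally have "vertex_weight E (\<omega> t) x \<le> real (card E) * exp K" by simp
    moreover have "e \<in> E" using e incident_subset by blast
    ultimately show ?thesis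
      unfolding share_def using bnd(1)[OF t] vertex_pos[OF t x] edge_pos[OF t]
      by (intro frac_le) (auto intro: less_imp_le)
  qed
  moreover have "0 < exp (- K) / (real (card E) * exp K)" using card_E_pos by simp
  ultimately show thesis using that by blast
qed

text \<open>
  The variances are taken around \<open>mean_excess\<close>; with the shares bounded below by \<open>p\<^sub>0\<close>, the Poincare
  inequality bounds their sum below by a fixed multiple of \<open>\<Sum>e. (excess e)\<^sup>2\<close>, and Gronwall's inequality
  applies.
\<close>

lemma excess_decays:
  assumes d: "max_density_condition V E"
  obtains C r where "0 < C" "0 < r"
    and "\<And>t e. 0 \<le> t \<Longrightarrow> e \<in> E \<Longrightarrow> \<bar>excess (\<omega> t) e\<bar> \<le> C * exp (- r * t)"
proof -
  obtain p\<^sub>0 where p0: "0 < p\<^sub>0"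
    and p: "\<And>t x e. 0 \<le> t \<Longrightarrow> x \<in> V \<Longrightarrow> e \<in> incident x \<Longrightarrow> p\<^sub>0 \<le> share (\<omega> t) x e"
    by (rule shares_bounded_below[OF d]) (rule that)
  obtain P where P: "0 < P" and poincare: "\<And>(k :: 'v set \<Rightarrow> real) (a :: 'v \<Rightarrow> real).
      (\<Sum>e\<in>E. k e) = 0 \<Longrightarrow>
      (\<Sum>e\<in>E. (k e)\<^sup>2) \<le> P * (\<Sum>x\<in>V. \<Sum>e\<in>incident x. (k e - a x)\<^sup>2)"
    by (rule poincare_incidences) (rule that)
  define g where "g t = (\<Sum>e\<in>E. (excess (\<omega> t) e)\<^sup>2)" for t
  define r where "r = 4 * p\<^sub>0 / P"
  have r: "0 < r" using p0 P by (simp add: r_def)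
  have g0: "0 \<le> g t" for t unfolding g_def by (intro sum_nonneg) auto
  have decay: "g t \<le> g 0 * exp (- r * t)" if "0 \<le> t" for t
  proof (rule gronwall_half_line[OF sum_excess_square_derivative[folded g_def] _ that])
    fix t :: real assume t: "0 \<le> t"
    let ?k = "excess (\<omega> t)" and ?a = "mean_excess t"
    have "p\<^sub>0 * g t \<le> p\<^sub>0 * (P * (\<Sum>x\<in>V. \<Sum>e\<in>incident x. (?k e - ?a x)\<^sup>2))"
      unfolding g_def using p0 poincare[OF sum_excess[OF positive[OF t]], of ?a]
      by (intro mult_left_mono) auto
    also have "\<dots> = P * (\<Sum>x\<in>V. \<Sum>e\<in>incident x. p\<^sub>0 * (?k e - ?a x)\<^sup>2)"
      by (simp add: sum_distrib_left mult_ac)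
    also have "\<dots> \<le> P * (\<Sum>x\<in>V. \<Sum>e\<in>incident x. share (\<omega> t) x e * (?k e - ?a x)\<^sup>2)"
      using P by (intro mult_left_mono sum_mono mult_right_mono p t) auto
    finally show "- 4 * (\<Sum>x\<in>V. \<Sum>e\<in>incident x. share (\<omega> t) x e * (?k e - ?a x)\<^sup>2) \<le> - r * g t"
      using P by (simp add: r_def field_simps)
  qed
  have "\<bar>excess (\<omega> t) e\<bar> \<le> (sqrt (g 0) + 1) * exp (- (r / 2) * t)" if t: "0 \<le> t" and e: "e \<in> E" for t e
  proof -
    have "(excess (\<omega> t) e)\<^sup>2 \<le> g t"
      unfolding g_def by (rule member_le_sum[where f="\<lambda>e. (excess (\<omega> t) e)\<^sup>2"]) (use e finite_E in auto)
    also have "\<dots> \<le> g 0 * exp (- r * t)" by (rule decay[OF t])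
    also have "\<dots> = (sqrt (g 0) * exp (- (r / 2) * t))\<^sup>2"
      using g0 by (simp add: power_mult_distrib flip: exp_double)
    finally have "\<bar>excess (\<omega> t) e\<bar> \<le> sqrt (g 0) * exp (- (r / 2) * t)"
      using g0 by (metis abs_le_square_iff abs_of_nonneg exp_ge_zero mult_nonneg_nonneg real_sqrt_ge_zero)
    also have "\<dots> \<le> (sqrt (g 0) + 1) * exp (- (r / 2) * t)" by (intro mult_right_mono) auto
    finally show ?thesis .
  qed
  \<comment> \<open>The added 1 makes the constant positive even if the flow starts at an equilibrium.\<close>
  moreover have "0 < sqrt (g 0) + 1" using real_sqrt_ge_zero[OF g0[of 0]] by linarith
  ultimately show thesis using that[of "sqrt (g 0) + 1" "r / 2"] r by simp
qed

lemma converges_to_zero_excess: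
  assumes d: "max_density_condition V E"
  obtains \<eta> C r where "positive_weight E \<eta>" "\<And>e. e \<in> E \<Longrightarrow> excess \<eta> e = 0" "0 < C" "0 < r"
    and "\<And>t e. 0 \<le> t \<Longrightarrow> e \<in> E \<Longrightarrow> \<bar>\<omega> t e - \<eta> e\<bar> \<le> C * exp (- r * t)"
proof -
  obtain K where bnd: "\<And>t e. 0 \<le> t \<Longrightarrow> e \<in> E \<Longrightarrow> exp (- K) \<le> \<omega> t e"
      "\<And>t e. 0 \<le> t \<Longrightarrow> e \<in> E \<Longrightarrow> \<omega> t e \<le> exp K"
    by (rule weights_bounded[OF d]) (rule that)
  obtain C r where Cr: "0 < C" "0 < r"
    and ex: "\<And>t e. 0 \<le> t \<Longrightarrow> e \<in> E \<Longrightarrow> \<bar>excess (\<omega> t) e\<bar> \<le> C * exp (- r * t)"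
    by (rule excess_decays[OF d]) (rule that)
  define C' where "C' = C * exp K / r"
  have "\<exists>L. \<forall>t\<ge>0. \<bar>\<omega> t e - L\<bar> \<le> C' * exp (- r * t)" if e: "e \<in> E" for e
  proof -
    have "\<bar>- excess (\<omega> t) e * \<omega> t e\<bar> \<le> C * exp K * exp (- r * t)" if t: "0 \<le> t" for t
    proof -
      have "\<bar>excess (\<omega> t) e\<bar> * \<omega> t e \<le> (C * exp (- r * t)) * exp K"
        using ex[OF t e] bnd[OF t e] edge_pos[OF t e] Cr by (intro mult_mono) auto
      then show ?thesis using edge_pos[OF t e] by (simp add: abs_mult mult_ac)
    qed
    then show ?thesis
      using exponential_limit_half_line[OF flow[OF _ e] _ Cr(2), of "C * exp K"]
      unfolding C'_def by metis
  qed
  then obtain \<eta> where \<eta>: "\<And>e t. e \<in> E \<Longrightarrow> 0 \<le> t \<Longrightarrow> \<bar>\<omega> t e - \<eta> e\<bar> \<le> C' * exp (- r * t)"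
    by metis
  have lim: "((\<lambda>t. \<omega> t e) \<longlongrightarrow> \<eta> e) at_top" if "e \<in> E" for e
    by (rule tendsto_of_exponential_bound[OF \<eta>[OF that] Cr(2)])
  have "exp (- K) \<le> \<eta> e" if e: "e \<in> E" for e
  proof (rule tendsto_lowerbound[OF lim[OF e]])
    show "\<forall>\<^sub>F t in at_top. exp (- K) \<le> \<omega> t e"
      using eventually_ge_at_top[of 0] by eventually_elim (use bnd e in auto)
  qed simp
  then have pos: "positive_weight E \<eta>"
    unfolding positive_weight_def using exp_gt_zero less_le_trans by blast
  have "excess \<eta> e = 0" if e: "e \<in> E" for e
  proof -
    have "((\<lambda>t. excess (\<omega> t) e) \<longlongrightarrow> excess \<eta> e) at_top"
      unfolding excess_def share_def
    proof (intro tendsto_diff tendsto_mult tendsto_const tendsto_sum tendsto_divide lim e)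
      fix x assume x: "x \<in> e"
      show "((\<lambda>t. vertex_weight E (\<omega> t) x) \<longlongrightarrow> vertex_weight E \<eta> x) at_top"
        unfolding vertex_weight_incident by (intro tendsto_sum lim) (use incident_subset in blast)
      have "x \<in> V" using x e edge_subset by blast
      then show "vertex_weight E \<eta> x \<noteq> 0" using vertex_weight_positive[OF pos] by fastforce
    qed
    moreover have "((\<lambda>t. excess (\<omega> t) e) \<longlongrightarrow> 0) at_top"
      by (rule tendsto_of_exponential_bound[OF _ Cr(2), where C=C]) (use ex e in auto)
    ultimately show ?thesis by (rule tendsto_unique[rotated]) simp
  qed
  moreover have "0 < C'" using Cr by (simp add: C'_def)
  ultimately show thesis using that[OF pos] \<eta> Cr(2) by blast
qed

end

lemma (in connected_simple_graph) excess_scale: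
  assumes "c \<noteq> 0" shows "excess (\<lambda>e. c * \<omega> e) e = excess \<omega> e"
  using assms by (simp add: excess_def share_def vertex_weight_def flip: sum_distrib_left)

text \<open>
  Scaling by a function of time does not change \<open>excess\<close>, so a flow with any constant \<open>c\<close> becomes the normalized
  one. The un-normalized flow is the case \<open>c = 0\<close>; for the normalized one the scaling factor is \<open>1\<close>.
\<close>

lemma (in connected_simple_graph) normalized_flow_of_solution:
  assumes g: "6 \<le> girth E" and sol: "ricci_flow_solution V E c \<omega>\<^sub>0 \<omega>"
  defines "s \<equiv> mean_curvature V E - c"
  shows "normalized_flow V E (\<lambda>t e. exp (s * t) * \<omega> t e)"
proof unfold_locales
  fix t :: real assume t: "0 \<le> t"
  have pos: "positive_weight E (\<omega> t)" using sol t by (simp add: ricci_flow_solution_def)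
  then show "positive_weight E (\<lambda>e. exp (s * t) * \<omega> t e)" by (simp add: positive_weight_def)
  fix e assume e: "e \<in> E"
  have d: "((\<lambda>s. \<omega> s e) has_real_derivative - (edge_curvature V E (\<omega> t) e - c) * \<omega> t e) (at t within {0..})"
    using sol t e by (simp add: ricci_flow_solution_def)
  have "edge_curvature V E (\<omega> t) e - c = excess (\<omega> t) e + s"
    using edge_curvature_excess[OF g pos e] by (simp add: s_def)
  moreover have "excess (\<lambda>e. exp (s * t) * \<omega> t e) e = excess (\<omega> t) e"
    by (rule excess_scale) simp
  ultimately show "((\<lambda>u. exp (s * u) * \<omega> u e) has_real_derivative
      - excess (\<lambda>e. exp (s * t) * \<omega> t e) e * (exp (s * t) * \<omega> t e)) (at t within {0..})"
    by (auto intro!: derivative_eq_intros d simp: algebra_simps)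
qed

theorem theorem1p2:
  fixes V :: "'v set" and E :: "'v set set" and \<omega>\<^sub>0 :: "'v set \<Rightarrow> real"
  assumes "simple_graph V E" and "connected_graph V E" and "E \<noteq> {}" and "6 \<le> girth E"
    and "positive_weight E \<omega>\<^sub>0"
  shows "(\<forall>\<omega>. ricci_flow_solution V E (mean_curvature V E) \<omega>\<^sub>0 \<omega> \<longrightarrow>
            (converges_exp_to_constant_curvature V E (mean_curvature V E) \<omega> \<longleftrightarrow>
             max_density_condition V E)) \<and>
         (max_density_condition V E \<longrightarrow>
            (\<forall>\<omega>'. ricci_flow_solution V E 0 \<omega>\<^sub>0 \<omega>' \<longrightarrow>
              (\<forall>e\<in>E. \<exists>C>0. \<exists>r>0. \<forall>t\<ge>0.
                 \<bar>edge_curvature V E (\<omega>' t) e - mean_curvature V E\<bar> \<le> C * exp (- r * t))))"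
proof -
  interpret connected_simple_graph V E by unfold_locales fact+
  note girth = assms(4)
  show ?thesis
  proof (intro conjI allI impI iffI ballI)
    fix \<omega> assume "converges_exp_to_constant_curvature V E (mean_curvature V E) \<omega>"
    then obtain \<eta> where "positive_weight E \<eta>" "\<forall>e\<in>E. edge_curvature V E \<eta> e = mean_curvature V E"
      unfolding converges_exp_to_constant_curvature_def by blast
    then show "max_density_condition V E"
      using constant_curvature_imp_density edge_curvature_excess[OF girth] by fastforce
  next
    fix \<omega> assume "ricci_flow_solution V E (mean_curvature V E) \<omega>\<^sub>0 \<omega>"
      and d: "max_density_condition V E"
    then interpret normalized_flow V E \<omega>
      using normalized_flow_of_solution[OF girth, of "mean_curvature V E"] by simp
    obtain \<eta> C r where \<eta>: "positive_weight E \<eta>" "\<And>e. e \<in> E \<Longrightarrow> excess \<eta> e = 0" and Cr: "0 < C" "0 < r"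
      and conv: "\<And>t e. 0 \<le> t \<Longrightarrow> e \<in> E \<Longrightarrow> \<bar>\<omega> t e - \<eta> e\<bar> \<le> C * exp (- r * t)"
      by (rule converges_to_zero_excess[OF d]) (rule that)
    have "L2_set (\<lambda>e. \<omega> t e - \<eta> e) E \<le> (real (card E) * C) * exp (- r * t)" if t: "0 \<le> t" for t
    proof -
      have "L2_set (\<lambda>e. \<omega> t e - \<eta> e) E \<le> (\<Sum>e\<in>E. \<bar>\<omega> t e - \<eta> e\<bar>)" by (rule L2_set_le_sum_abs)
      also have "\<dots> \<le> (\<Sum>e\<in>E. C * exp (- r * t))" by (intro sum_mono conv t)
      finally show ?thesis by simp
    qed
    moreover have "0 < real (card E) * C" using Cr card_E_pos by simp
    moreover have "\<forall>e\<in>E. edge_curvature V E \<eta> e = mean_curvature V E"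
      using edge_curvature_excess[OF girth \<eta>(1)] \<eta>(2) by fastforce
    ultimately show "converges_exp_to_constant_curvature V E (mean_curvature V E) \<omega>"
      unfolding converges_exp_to_constant_curvature_def using \<eta>(1) Cr(2) by blast
  next
    fix \<omega>' e assume d: "max_density_condition V E" and sol: "ricci_flow_solution V E 0 \<omega>\<^sub>0 \<omega>'"
      and e: "e \<in> E"
    interpret normalized_flow V E "\<lambda>t e. exp ((mean_curvature V E - 0) * t) * \<omega>' t e"
      by (rule normalized_flow_of_solution[OF girth sol])
    obtain C r where Cr: "0 < C" "0 < r" and decay: "\<And>t e. 0 \<le> t \<Longrightarrow> e \<in> E \<Longrightarrow>
        \<bar>excess (\<lambda>e. exp ((mean_curvature V E - 0) * t) * \<omega>' t e) e\<bar> \<le> C * exp (- r * t)"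
      by (rule excess_decays[OF d]) (rule that)
    have "\<bar>edge_curvature V E (\<omega>' t) e - mean_curvature V E\<bar> \<le> C * exp (- r * t)" if t: "0 \<le> t" for t
    proof -
      have "positive_weight E (\<omega>' t)" using sol t by (simp add: ricci_flow_solution_def)
      then show ?thesis
        using decay[OF t e] edge_curvature_excess[OF girth _ e] by (simp add: excess_scale)
    qed
    then show "\<exists>C>0. \<exists>r>0. \<forall>t\<ge>0.
        \<bar>edge_curvature V E (\<omega>' t) e - mean_curvature V E\<bar> \<le> C * exp (- r * t)"
      using Cr by blast
  qed
qed

end
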